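(* Let $X$ be a compact connected 8-manifold with a $\mathrm{Spin}(7)$-structure $\Phi$ and let $L\to X$ be a smooth complex line bundle with a Hermitian metric $h$. Let $\nabla$ be a Hermitian connection of $(L,h)$ satisfying $*F_\nabla^4/24\neq1$ (i.e. $*F_\nabla^4/24-1$ is nowhere vanishing). If $\pi^2_7\left(F_\nabla+\frac16 *F_\nabla^3\right)=0$, then $\pi^4_7(F_\nabla^2)=0$.
   Context: A $\mathrm{Spin}(7)$-structure on an oriented 8-manifold $X$ is a 4-form $\Phi$ such that at each point there is a positively oriented basis of the tangent space with dual basis $e^0,\dots,e^7$ for which, with $e^{ijkl}=e^i\wedge e^j\wedge e^k\wedge e^l$, $$\Phi=e^{0123}+e^{0145}+e^{0167}+e^{0246}-e^{0257}-e^{0347}-e^{0356}+e^{4567}+e^{2367}+e^{2345}+e^{1357}-e^{1346}-e^{1256}-e^{1247}.$$ It determines a metric and volume form for which such bases are oriented orthonormal; $*$ is the Hodge star. $\Omega^k_\ell$ denotes sections of the subbundle $\Lambda^k_\ell\subset\Lambda^kT^*X$ corresponding to the $\ell$-dimensional irreducible representation of $\mathrm{Spin}(7)$ and $\pi^k_\ell$ the (orthogonal) projection. Explicitly $\Lambda^2_7=\{\alpha: *(\Phi\wedge\alpha)=3\alpha\}$ and, pointwise, $\Lambda^4_7=\{e^0\wedge i(\alpha^\sharp)*_7\varphi-\alpha\wedge\varphi:\alpha\in\mathrm{span}(e^1,\dots,e^7)\}$, where $\Phi=e^0\wedge\varphi+*_7\varphi$ with $\varphi=e^{123}+e^{145}+e^{167}+e^{246}-e^{257}-e^{347}-e^{356}$.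 The curvature $F_\nabla$ is regarded as a $\sqrt{-1}\,\mathbb R$-valued closed 2-form on $X$ (projections and $*$ are extended complex-linearly). *)

theory Defs
  imports "HOL-Analysis.Analysis" "HOL-Library.Function_Algebras"
begin

text \<open>Functions with values in a real vector space, with the pointwise operations. This makes
  derivations and multilinear forms into vectors, so that \<^const>\<open>span\<close>, \<^const>\<open>independent\<close>
  and \<^const>\<open>representation\<close> apply to tangent spaces.\<close>

instantiation "fun" :: (type, real_vector) real_vector
begin

definition scaleR_fun :: "real \<Rightarrow> ('a \<Rightarrow> 'b) \<Rightarrow> 'a \<Rightarrow> 'b" where
  "scaleR_fun c f = (\<lambda>x. c *\<^sub>R f x)"

instance
  by standard
    (simp_all add: scaleR_fun_def fun_eq_iff scaleR_add_right scaleR_add_left)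

end


section \<open>Smooth manifolds and tangent vectors\<close>

primrec Ck_on :: "nat \<Rightarrow> 'a::euclidean_space set \<Rightarrow> ('a \<Rightarrow> 'b::real_normed_vector) \<Rightarrow> bool" where
  "Ck_on 0 S f \<longleftrightarrow> continuous_on S f"
| "Ck_on (Suc k) S f \<longleftrightarrow>
     f differentiable_on S \<and> (\<forall>b\<in>Basis. Ck_on k S (\<lambda>x. frechet_derivative f (at x) b))"

text \<open>Only used for open \<^term>\<open>S\<close>.\<close>

definition Cinf_on :: "'a::euclidean_space set \<Rightarrow> ('a \<Rightarrow> 'b::real_normed_vector) \<Rightarrow> bool" where
  "Cinf_on S f \<longleftrightarrow> (\<forall>k. Ck_on k S f)"

type_synonym 'm atlas = "('m set \<times> ('m \<Rightarrow> real^8)) set"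

text \<open>An oriented smooth structure of dimension 8 on the whole type \<^typ>\<open>'m\<close>; the Hausdorff and
  second countability axioms are the sort constraint.\<close>

definition oriented_atlas ::
    "'m::{t2_space, second_countable_topology} atlas \<Rightarrow> bool" where
  "oriented_atlas A \<longleftrightarrow>
     (\<Union>(U, \<phi>)\<in>A. U) = UNIV \<and>
     (\<forall>(U, \<phi>)\<in>A. open U \<and> open (\<phi> ` U) \<and> homeomorphism U (\<phi> ` U) \<phi> (inv_into U \<phi>)) \<and>
     (\<forall>(U, \<phi>)\<in>A. \<forall>(V, \<psi>)\<in>A.
        Cinf_on (\<phi> ` (U \<inter> V)) (\<psi> \<circ> inv_into U \<phi>) \<and>
        (\<forall>x\<in>\<phi> ` (U \<inter> V).
           det (matrix (frechet_derivative (\<psi> \<circ> inv_into U \<phi>) (at x))) > 0))"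

definition smooth_fun ::
    "'m::topological_space atlas \<Rightarrow> 'm set \<Rightarrow> ('m \<Rightarrow> 'b::real_normed_vector) \<Rightarrow> bool" where
  "smooth_fun A W f \<longleftrightarrow>
     open W \<and> (\<forall>(U, \<phi>)\<in>A. Cinf_on (\<phi> ` (W \<inter> U)) (f \<circ> inv_into U \<phi>))"

definition smooth_near ::
    "'m::topological_space atlas \<Rightarrow> 'm \<Rightarrow> ('m \<Rightarrow> 'b::real_normed_vector) \<Rightarrow> bool" where
  "smooth_near A p f \<longleftrightarrow> (\<exists>W. p \<in> W \<and> smooth_fun A W f)"

type_synonym 'm tangent = "('m \<Rightarrow> real) \<Rightarrow> real"

text \<open>Tangent vectors at \<^term>\<open>p\<close> are the derivations at \<^term>\<open>p\<close> of the functions that are smooth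
  near \<^term>\<open>p\<close>; the value 0 on all other functions makes them extensional. They only depend on the
  germ of the function: if \<^term>\<open>f\<close> vanishes near \<^term>\<open>p\<close>, apply the Leibniz rule to
  \<^term>\<open>f * u\<close> with \<^term>\<open>u\<close> the indicator function of the complement of a neighbourhood
  of \<^term>\<open>p\<close>.\<close>

definition tangent_space :: "'m::topological_space atlas \<Rightarrow> 'm \<Rightarrow> 'm tangent set" where
  "tangent_space A p = {v.
     (\<forall>f. \<not> smooth_near A p f \<longrightarrow> v f = 0) \<and>
     (\<forall>f g a b. smooth_near A p f \<and> smooth_near A p g \<longrightarrow>
        v (\<lambda>q. a * f q + b * g q) = a * v f + b * v g \<and>
        v (\<lambda>q. f q * g q) = v f * g p + f p * v g)}"

definition smooth_vector_field ::
    "'m::topological_space atlas \<Rightarrow> ('m \<Rightarrow> 'm tangent) \<Rightarrow> bool" where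
  "smooth_vector_field A V \<longleftrightarrow>
     (\<forall>p. V p \<in> tangent_space A p) \<and>
     (\<forall>W f. smooth_fun A W f \<longrightarrow> smooth_fun A W (\<lambda>p. V p f))"

definition lie_bracket ::
    "'m::topological_space atlas \<Rightarrow> ('m \<Rightarrow> 'm tangent) \<Rightarrow> ('m \<Rightarrow> 'm tangent) \<Rightarrow> 'm \<Rightarrow> 'm tangent" where
  "lie_bracket A V W p f =
     (if smooth_near A p f then V p (\<lambda>q. W q f) - W p (\<lambda>q. V q f) else 0)"

definition tangent_complex :: "'m tangent \<Rightarrow> ('m \<Rightarrow> complex) \<Rightarrow> complex" where
  "tangent_complex v f = Complex (v (\<lambda>q. Re (f q))) (v (\<lambda>q. Im (f q)))"


section \<open>Exterior algebra\<close>

text \<open>A (complex-valued) form takes the list of its arguments. A \<^term>\<open>k\<close>-form on \<^term>\<open>T\<close> is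
  zero on lists of length different from \<^term>\<open>k\<close> and on lists that leave \<^term>\<open>T\<close>.\<close>

type_synonym 't form = "'t list \<Rightarrow> complex"

definition alt_forms :: "'t::real_vector set \<Rightarrow> nat \<Rightarrow> 't form set" where
  "alt_forms T k = {\<alpha>.
     (\<forall>vs. \<alpha> vs \<noteq> 0 \<longrightarrow> length vs = k \<and> set vs \<subseteq> T \<and> distinct vs) \<and>
     (\<forall>xs ys u v a b. Suc (length xs + length ys) = k \<and> set xs \<union> set ys \<union> {u, v} \<subseteq> T \<longrightarrow>
        \<alpha> (xs @ (a *\<^sub>R u + b *\<^sub>R v) # ys) = a *\<^sub>R \<alpha> (xs @ u # ys) + b *\<^sub>R \<alpha> (xs @ v # ys))}"

definition real_forms :: "'t::real_vector set \<Rightarrow> nat \<Rightarrow> 't form set" where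
  "real_forms T k = {\<alpha> \<in> alt_forms T k. range \<alpha> \<subseteq> \<real>}"

text \<open>Sum over shuffles: \<^term>\<open>S\<close> is the set of positions whose arguments go to \<^term>\<open>\<alpha>\<close>, and the
  exponent counts the inversions of the shuffle. With this normalisation
  \<open>(e\<^sup>i \<and> e\<^sup>j)(e\<^sub>i, e\<^sub>j) = 1\<close>. No degrees are needed, since forms vanish on
  lists of the wrong length.\<close>

definition wedge :: "'t form \<Rightarrow> 't form \<Rightarrow> 't form" where
  "wedge \<alpha> \<beta> vs = (\<Sum>S\<in>Pow {..<length vs}.
     (-1) ^ card {(i, j). i \<in> S \<and> j \<in> {..<length vs} - S \<and> j < i}
       * \<alpha> (nths vs S) * \<beta> (nths vs (- S)))"

definition unit_form :: "'t form" where
  "unit_form vs = (if vs = [] then 1 else 0)"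

definition wedge_power :: "'t form \<Rightarrow> nat \<Rightarrow> 't form" where
  "wedge_power \<alpha> n = (wedge \<alpha> ^^ n) unit_form"

definition interior :: "'t \<Rightarrow> 't form \<Rightarrow> 't form" where
  "interior v \<omega> vs = \<omega> (v # vs)"

definition smooth_form ::
    "'m::topological_space atlas \<Rightarrow> nat \<Rightarrow> ('m \<Rightarrow> 'm tangent form) \<Rightarrow> bool" where
  "smooth_form A k \<omega> \<longleftrightarrow>
     (\<forall>p. \<omega> p \<in> alt_forms (tangent_space A p) k) \<and>
     (\<forall>Vs. length Vs = k \<and> (\<forall>V\<in>set Vs. smooth_vector_field A V) \<longrightarrow>
        smooth_fun A UNIV (\<lambda>p. \<omega> p (map (\<lambda>V. V p) Vs)))"


section \<open>Bases and the structures they determine\<close>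

text \<open>Bases are indexed by the eight-element type \<^typ>\<open>8\<close>, whose elements are written
  \<open>0, \<dots>, 7\<close>.\<close>

definition basis_of :: "'t::real_vector set \<Rightarrow> (8 \<Rightarrow> 't) \<Rightarrow> bool" where
  "basis_of T e \<longleftrightarrow> inj e \<and> independent (range e) \<and> span (range e) = T"

definition dual_basis :: "(8 \<Rightarrow> 't::real_vector) \<Rightarrow> 8 \<Rightarrow> 't form" where
  "dual_basis e i vs =
     (case vs of [v] \<Rightarrow> of_real (representation (range e) v (e i)) | _ \<Rightarrow> 0)"

text \<open>\<open>e\<^sup>i\<^sup>j\<^sup>k\<^sup>l\<close> is \<^term>\<open>dual_wedge e [i, j, k, l]\<close>.\<close>

definition dual_wedge :: "(8 \<Rightarrow> 't::real_vector) \<Rightarrow> 8 list \<Rightarrow> 't form" where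
  "dual_wedge e is = foldr (\<lambda>i. wedge (dual_basis e i)) is unit_form"

definition subframe :: "(8 \<Rightarrow> 't) \<Rightarrow> nat set \<Rightarrow> 't list" where
  "subframe e I = nths (map e [0, 1, 2, 3, 4, 5, 6, 7]) I"

text \<open>The inner product, volume form and Hodge star of the metric and orientation for which
  \<^term>\<open>e\<close> is an oriented orthonormal basis. The inner product is extended complex-bilinearly. The
  Hodge star is the contraction of the form with the volume form, that is the linear map with
  \<open>* e\<^sup>I = \<plusminus> e\<^sup>J\<close>, where \<open>J\<close> is the complement of \<open>I\<close> and the sign is
  such that \<open>e\<^sup>I \<and> * e\<^sup>I = vol\<close>; it is complex-linear.\<close>

definition form_inner :: "(8 \<Rightarrow> 't) \<Rightarrow> 't form \<Rightarrow> 't form \<Rightarrow> complex" where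
  "form_inner e \<alpha> \<beta> = (\<Sum>I\<in>Pow {..<8}. \<alpha> (subframe e I) * \<beta> (subframe e I))"

definition volume_form :: "(8 \<Rightarrow> 't::real_vector) \<Rightarrow> 't form" where
  "volume_form e = dual_wedge e [0, 1, 2, 3, 4, 5, 6, 7]"

definition hodge :: "(8 \<Rightarrow> 't::real_vector) \<Rightarrow> 't form \<Rightarrow> 't form" where
  "hodge e \<beta> vs = (\<Sum>I\<in>Pow {..<8}. \<beta> (subframe e I) * volume_form e (subframe e I @ vs))"

definition complexification :: "'t form set \<Rightarrow> 't form set" where
  "complexification S = {(\<lambda>vs. \<gamma> vs + \<i> * \<delta> vs) | \<gamma> \<delta>. \<gamma> \<in> S \<and> \<delta> \<in> S}"

text \<open>For a linear subspace \<^term>\<open>S\<close> of the real forms: the complex-linear extension of the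
  orthogonal projection onto \<^term>\<open>S\<close>.\<close>

definition orth_proj :: "(8 \<Rightarrow> 't) \<Rightarrow> 't form set \<Rightarrow> 't form \<Rightarrow> 't form" where
  "orth_proj e S \<alpha> = (THE \<beta>. \<beta> \<in> complexification S \<and> (\<forall>\<gamma>\<in>S. form_inner e (\<alpha> - \<beta>) \<gamma> = 0))"


section \<open>Spin(7)-structures\<close>

definition standard_Phi :: "(8 \<Rightarrow> 't::real_vector) \<Rightarrow> 't form" where
  "standard_Phi e =
     dual_wedge e [0,1,2,3] + dual_wedge e [0,1,4,5] + dual_wedge e [0,1,6,7]
     + dual_wedge e [0,2,4,6] - dual_wedge e [0,2,5,7] - dual_wedge e [0,3,4,7]
     - dual_wedge e [0,3,5,6] + dual_wedge e [4,5,6,7] + dual_wedge e [2,3,6,7]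
     + dual_wedge e [2,3,4,5] + dual_wedge e [1,3,5,7] - dual_wedge e [1,3,4,6]
     - dual_wedge e [1,2,5,6] - dual_wedge e [1,2,4,7]"

text \<open>\<open>standard_Phi e = e\<^sup>0 \<and> G2_phi e + G2_star_phi e\<close>\<close>

definition G2_phi :: "(8 \<Rightarrow> 't::real_vector) \<Rightarrow> 't form" where
  "G2_phi e =
     dual_wedge e [1,2,3] + dual_wedge e [1,4,5] + dual_wedge e [1,6,7]
     + dual_wedge e [2,4,6] - dual_wedge e [2,5,7] - dual_wedge e [3,4,7]
     - dual_wedge e [3,5,6]"

definition G2_star_phi :: "(8 \<Rightarrow> 't::real_vector) \<Rightarrow> 't form" where
  "G2_star_phi e =
     dual_wedge e [4,5,6,7] + dual_wedge e [2,3,6,7] + dual_wedge e [2,3,4,5]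
     + dual_wedge e [1,3,5,7] - dual_wedge e [1,3,4,6] - dual_wedge e [1,2,5,6]
     - dual_wedge e [1,2,4,7]"

definition positively_oriented ::
    "'m::topological_space atlas \<Rightarrow> 'm \<Rightarrow> (8 \<Rightarrow> 'm tangent) \<Rightarrow> bool" where
  "positively_oriented A p e \<longleftrightarrow>
     (\<forall>(U, \<phi>)\<in>A. p \<in> U \<longrightarrow> det (\<chi> i j. e j (\<lambda>q. \<phi> q $ i)) > 0)"

definition spin7_basis ::
    "'m::topological_space atlas \<Rightarrow> ('m \<Rightarrow> 'm tangent form) \<Rightarrow> 'm \<Rightarrow> (8 \<Rightarrow> 'm tangent) \<Rightarrow> bool" where
  "spin7_basis A \<Phi> p e \<longleftrightarrow>
     basis_of (tangent_space A p) e \<and> positively_oriented A p e \<and> \<Phi> p = standard_Phi e"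

definition spin7_structure ::
    "'m::topological_space atlas \<Rightarrow> ('m \<Rightarrow> 'm tangent form) \<Rightarrow> bool" where
  "spin7_structure A \<Phi> \<longleftrightarrow> smooth_form A 4 \<Phi> \<and> (\<forall>p. \<exists>e. spin7_basis A \<Phi> p e)"

text \<open>Any two Spin(7)-bases at a point differ by an element of the stabiliser of the standard form,
  which is Spin(7) and lies in SO(8). So the metric, the volume form, the Hodge star and the
  Spin(7)-invariant subspaces below are independent of the basis chosen to express them.\<close>

definition some_spin7_basis ::
    "'m::topological_space atlas \<Rightarrow> ('m \<Rightarrow> 'm tangent form) \<Rightarrow> 'm \<Rightarrow> 8 \<Rightarrow> 'm tangent" where
  "some_spin7_basis A \<Phi> p = (SOME e. spin7_basis A \<Phi> p e)"

definition spin7_hodge :: "'m::topological_space atlas \<Rightarrow> ('m \<Rightarrow> 'm tangent form) \<Rightarrow> 'm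
    \<Rightarrow> 'm tangent form \<Rightarrow> 'm tangent form" where
  "spin7_hodge A \<Phi> p = hodge (some_spin7_basis A \<Phi> p)"

definition Lambda_2_7 :: "'m::topological_space atlas \<Rightarrow> ('m \<Rightarrow> 'm tangent form) \<Rightarrow> 'm
    \<Rightarrow> 'm tangent form set" where
  "Lambda_2_7 A \<Phi> p =
     {\<alpha> \<in> real_forms (tangent_space A p) 2. spin7_hodge A \<Phi> p (wedge (\<Phi> p) \<alpha>) = 3 *\<^sub>R \<alpha>}"

text \<open>Here \<open>\<alpha> = \<Sum>i. a i *\<^sub>R e\<^sup>i\<close> with \<open>a 0 = 0\<close>; since \<open>e\<close> is
  orthonormal, the metric dual of \<open>\<alpha>\<close> is \<open>\<Sum>i. a i *\<^sub>R e i\<close>.\<close>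

definition Lambda_4_7 :: "'m::topological_space atlas \<Rightarrow> ('m \<Rightarrow> 'm tangent form) \<Rightarrow> 'm
    \<Rightarrow> 'm tangent form set" where
  "Lambda_4_7 A \<Phi> p =
     (let e = some_spin7_basis A \<Phi> p in
      {wedge (dual_basis e 0) (interior (\<Sum>i\<in>UNIV. a i *\<^sub>R e i) (G2_star_phi e))
         - wedge (\<Sum>i\<in>UNIV. a i *\<^sub>R dual_basis e i) (G2_phi e) | a. a 0 = 0})"

definition pi_2_7 :: "'m::topological_space atlas \<Rightarrow> ('m \<Rightarrow> 'm tangent form) \<Rightarrow> 'm
    \<Rightarrow> 'm tangent form \<Rightarrow> 'm tangent form" where
  "pi_2_7 A \<Phi> p = orth_proj (some_spin7_basis A \<Phi> p) (Lambda_2_7 A \<Phi> p)"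

definition pi_4_7 :: "'m::topological_space atlas \<Rightarrow> ('m \<Rightarrow> 'm tangent form) \<Rightarrow> 'm
    \<Rightarrow> 'm tangent form \<Rightarrow> 'm tangent form" where
  "pi_4_7 A \<Phi> p = orth_proj (some_spin7_basis A \<Phi> p) (Lambda_4_7 A \<Phi> p)"


section \<open>Hermitian line bundles and connections\<close>

text \<open>A complex line bundle is a family of complex lines \<^term>\<open>L p\<close> in a complex vector space
  \<^typ>\<open>'v\<close> with scalar multiplication \<^term>\<open>sc\<close>, and its smooth structure is given by a set of local
  frames (nowhere vanishing local sections) with smooth transition functions. This is no restriction
  on the bundle, since the direct sum of all its fibres can be taken for \<^typ>\<open>'v\<close>.\<close>

definition line_bundle ::
    "'m::topological_space atlas \<Rightarrow> (complex \<Rightarrow> 'v::ab_group_add \<Rightarrow> 'v) \<Rightarrow> ('m \<Rightarrow> 'v set)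
     \<Rightarrow> ('m set \<times> ('m \<Rightarrow> 'v)) set \<Rightarrow> bool" where
  "line_bundle A sc L \<F> \<longleftrightarrow>
     vector_space sc \<and>
     (\<Union>(U, \<sigma>)\<in>\<F>. U) = UNIV \<and>
     (\<forall>(U, \<sigma>)\<in>\<F>. open U \<and> (\<forall>p\<in>U. \<sigma> p \<noteq> 0 \<and> L p = range (\<lambda>c. sc c (\<sigma> p)))) \<and>
     (\<forall>(U, \<sigma>)\<in>\<F>. \<forall>(V, \<tau>)\<in>\<F>.
        \<exists>g :: 'm \<Rightarrow> complex. smooth_fun A (U \<inter> V) g \<and> (\<forall>p\<in>U \<inter> V. \<tau> p = sc (g p) (\<sigma> p)))"

definition smooth_section ::
    "'m::topological_space atlas \<Rightarrow> (complex \<Rightarrow> 'v::ab_group_add \<Rightarrow> 'v) \<Rightarrow> ('m \<Rightarrow> 'v set)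
     \<Rightarrow> ('m set \<times> ('m \<Rightarrow> 'v)) set \<Rightarrow> ('m \<Rightarrow> 'v) \<Rightarrow> bool" where
  "smooth_section A sc L \<F> s \<longleftrightarrow>
     (\<forall>p. s p \<in> L p) \<and>
     (\<forall>(U, \<sigma>)\<in>\<F>. \<exists>f :: 'm \<Rightarrow> complex. smooth_fun A U f \<and> (\<forall>p\<in>U. s p = sc (f p) (\<sigma> p)))"

text \<open>Hermitian forms are complex-linear in the first argument.\<close>

definition hermitian_metric ::
    "'m::topological_space atlas \<Rightarrow> (complex \<Rightarrow> 'v::ab_group_add \<Rightarrow> 'v) \<Rightarrow> ('m \<Rightarrow> 'v set)
     \<Rightarrow> ('m set \<times> ('m \<Rightarrow> 'v)) set \<Rightarrow> ('m \<Rightarrow> 'v \<Rightarrow> 'v \<Rightarrow> complex) \<Rightarrow> bool" where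
  "hermitian_metric A sc L \<F> h \<longleftrightarrow>
     (\<forall>p. \<forall>u\<in>L p. \<forall>v\<in>L p. \<forall>w\<in>L p. \<forall>c. h p (sc c u + v) w = c * h p u w + h p v w) \<and>
     (\<forall>p. \<forall>u\<in>L p. \<forall>v\<in>L p. h p v u = cnj (h p u v)) \<and>
     (\<forall>p. \<forall>u\<in>L p. u \<noteq> 0 \<longrightarrow> Re (h p u u) > 0) \<and>
     (\<forall>(U, \<sigma>)\<in>\<F>. smooth_fun A U (\<lambda>p. h p (\<sigma> p) (\<sigma> p)))"

text \<open>\<^term>\<open>D V s\<close> is the covariant derivative of the section \<^term>\<open>s\<close> in the direction of the vector
  field \<^term>\<open>V\<close>.\<close>

definition connection ::
    "'m::topological_space atlas \<Rightarrow> (complex \<Rightarrow> 'v::ab_group_add \<Rightarrow> 'v) \<Rightarrow> ('m \<Rightarrow> 'v set)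
     \<Rightarrow> ('m set \<times> ('m \<Rightarrow> 'v)) set
     \<Rightarrow> (('m \<Rightarrow> 'm tangent) \<Rightarrow> ('m \<Rightarrow> 'v) \<Rightarrow> 'm \<Rightarrow> 'v) \<Rightarrow> bool" where
  "connection A sc L \<F> D \<longleftrightarrow>
     (\<forall>V s. smooth_vector_field A V \<and> smooth_section A sc L \<F> s \<longrightarrow>
        smooth_section A sc L \<F> (D V s)) \<and>
     (\<forall>V W s (f :: 'm \<Rightarrow> real) p.
        smooth_vector_field A V \<and> smooth_vector_field A W \<and>
        smooth_section A sc L \<F> s \<and> smooth_fun A UNIV f \<longrightarrow>
        D (\<lambda>q. f q *\<^sub>R V q + W q) s p = sc (of_real (f p)) (D V s p) + D W s p) \<and>
     (\<forall>V s t p.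
        smooth_vector_field A V \<and> smooth_section A sc L \<F> s \<and> smooth_section A sc L \<F> t \<longrightarrow>
        D V (\<lambda>q. s q + t q) p = D V s p + D V t p) \<and>
     (\<forall>V s (f :: 'm \<Rightarrow> complex) p.
        smooth_vector_field A V \<and> smooth_section A sc L \<F> s \<and> smooth_fun A UNIV f \<longrightarrow>
        D V (\<lambda>q. sc (f q) (s q)) p =
          sc (tangent_complex (V p) f) (s p) + sc (f p) (D V s p))"

definition hermitian_connection ::
    "'m::topological_space atlas \<Rightarrow> (complex \<Rightarrow> 'v::ab_group_add \<Rightarrow> 'v) \<Rightarrow> ('m \<Rightarrow> 'v set)
     \<Rightarrow> ('m set \<times> ('m \<Rightarrow> 'v)) set \<Rightarrow> ('m \<Rightarrow> 'v \<Rightarrow> 'v \<Rightarrow> complex)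
     \<Rightarrow> (('m \<Rightarrow> 'm tangent) \<Rightarrow> ('m \<Rightarrow> 'v) \<Rightarrow> 'm \<Rightarrow> 'v) \<Rightarrow> bool" where
  "hermitian_connection A sc L \<F> h D \<longleftrightarrow>
     connection A sc L \<F> D \<and>
     (\<forall>V s t p.
        smooth_vector_field A V \<and> smooth_section A sc L \<F> s \<and> smooth_section A sc L \<F> t \<longrightarrow>
        tangent_complex (V p) (\<lambda>q. h q (s q) (t q)) = h p (D V s p) (t p) + h p (s p) (D V t p))"

text \<open>\<^term>\<open>F\<close> is the curvature of the connection \<^term>\<open>D\<close>, regarded as a 2-form on the base: the
  endomorphism
  \<open>D\<^sub>V D\<^sub>W - D\<^sub>W D\<^sub>V - D\<^sub>[\<^sub>V\<^sub>,\<^sub>W\<^sub>]\<close>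
  of the line bundle is multiplication by \<open>F(V, W)\<close>. This determines \<^term>\<open>F\<close> uniquely. If
  \<^term>\<open>D\<close> is Hermitian, then \<^term>\<open>F\<close> is automatically imaginary-valued, and by the Bianchi
  identity it is closed.\<close>

definition curvature_form ::
    "'m::topological_space atlas \<Rightarrow> (complex \<Rightarrow> 'v::ab_group_add \<Rightarrow> 'v) \<Rightarrow> ('m \<Rightarrow> 'v set)
     \<Rightarrow> ('m set \<times> ('m \<Rightarrow> 'v)) set
     \<Rightarrow> (('m \<Rightarrow> 'm tangent) \<Rightarrow> ('m \<Rightarrow> 'v) \<Rightarrow> 'm \<Rightarrow> 'v) \<Rightarrow> ('m \<Rightarrow> 'm tangent form) \<Rightarrow> bool" where
  "curvature_form A sc L \<F> D F \<longleftrightarrow>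
     smooth_form A 2 F \<and>
     (\<forall>V W s p.
        smooth_vector_field A V \<and> smooth_vector_field A W \<and> smooth_section A sc L \<F> s \<longrightarrow>
        D V (D W s) p - D W (D V s) p - D (lie_bracket A V W) s p = sc (F p [V p, W p]) (s p))"

end

theory Submission
  imports Defs
begin

text \<open>
  The statement is one of linear algebra in a single tangent space. In a \<open>Spin(7)\<close>-frame a 2-form \<open>F\<close>
  becomes a skew \<open>8 \<times> 8\<close> matrix \<open>f\<close>, possibly complex, with \<open>* F\<^sup>4 / 24 = Pf(f)\<close>, and \<open>* F\<^sup>3 / 6\<close> becomes the
  matrix \<open>s\<close> of complementary Pfaffian minors (\<open>hodge_fourth_power\<close>, \<open>hodge_cube\<close>). Decompose
  \<open>so(8) = spin(7) \<oplus> m\<close> with \<open>m = \<Lambda>\<^sup>2\<^sub>7\<close> and write \<open>x\<^sub>m\<close> for the \<open>m\<close>-part of \<open>x\<close>. Four facts are combined.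

  \<^item> The map sending \<open>F\<close> to the \<open>\<Lambda>\<^sup>4\<^sub>7\<close>-part of \<open>F \<and> F\<close> is equivariant and quadratic. There is only one such map
    up to scaling, namely \<open>q(f) = [f, f\<^sub>m]\<^sub>m\<close> (\<open>coord4_square\<close>).
  \<^item> The pair is symmetric, so \<open>[f, g]\<^sub>m = [f, g\<^sub>m]\<^sub>m - [g, f\<^sub>m]\<^sub>m\<close> (\<open>coord2_bracket\<close>).
  \<^item> The matrices \<open>f\<close> and \<open>s\<close> commute, since \<open>f s = - Pf(f)\<close> (\<open>bracket_pf_adjugate\<close>).
  \<^item> By Jacobi's identity for Pfaffian minors and self-duality of \<open>\<Lambda>\<^sup>4\<^sub>7\<close>, \<open>q(s) = Pf(f) q(f)\<close>
    (\<open>coord4_pf_adjugate\<close>).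

  The hypothesis on \<open>F + * F\<^sup>3 / 6\<close> is \<open>s\<^sub>m = - f\<^sub>m\<close>. Hence
  \<open>q(f) = - [f, s\<^sub>m]\<^sub>m = - [s, f\<^sub>m]\<^sub>m = [s, s\<^sub>m]\<^sub>m = q(s) = Pf(f) q(f)\<close>,
  and \<open>q(f) = 0\<close> because \<open>Pf(f) \<noteq> 1\<close>.

  The remaining work connects this to forms. Wedge products, given as sums over shuffles, are computed
  by contracting with the first argument (\<open>wedge_Cons\<close>). The identity
  \<open>*(\<Phi> \<and> \<alpha>) + \<alpha> = \<Sum>\<^sub>k \<langle>\<alpha>, \<gamma>\<^sub>k\<rangle> \<gamma>\<^sub>k\<close> (\<open>hodge_Phi_wedge\<close>) identifies the eigenspace \<open>\<Lambda>\<^sup>2\<^sub>7\<close> with the span of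
  seven explicit orthogonal forms, and for subspaces with an orthogonal basis the vanishing of a
  projection means the vanishing of seven inner products (\<open>orth_proj_eq_0_iff\<close>).
\<close>

section \<open>Wedge products by recursion on the arguments\<close>

text \<open>Forms are total functions on lists of vectors, so the degree is a property of the support. Degree,
  antisymmetry and multilinearity are kept as three separate predicates, because most computations
  below only need one or two of them.\<close>

definition homogeneous :: "nat \<Rightarrow> 't form \<Rightarrow> bool" where
  "homogeneous k \<alpha> \<longleftrightarrow> (\<forall>vs. \<alpha> vs \<noteq> 0 \<longrightarrow> length vs = k)"

lemma homogeneousD: "homogeneous k \<alpha> \<Longrightarrow> length vs \<noteq> k \<Longrightarrow> \<alpha> vs = 0"
  by (auto simp: homogeneous_def)

lemma interior_add: "interior v (\<alpha> + \<beta>) = interior v \<alpha> + interior v \<beta>"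
  by (rule ext) (simp add: interior_def)
lemma interior_diff: "interior v (\<alpha> - \<beta>) = interior v \<alpha> - interior v \<beta>"
  by (rule ext) (simp add: interior_def)

lemma homogeneous_add: "homogeneous k \<alpha> \<Longrightarrow> homogeneous k \<beta> \<Longrightarrow> homogeneous k (\<alpha> + \<beta>)"
  unfolding homogeneous_def by (metis add_0 plus_fun_apply)
lemma homogeneous_diff: "homogeneous k \<alpha> \<Longrightarrow> homogeneous k \<beta> \<Longrightarrow> homogeneous k (\<alpha> - \<beta>)"
  unfolding homogeneous_def by (metis diff_0_right fun_diff_def)

lemma homogeneous_interior: "homogeneous (Suc k) \<alpha> \<Longrightarrow> homogeneous k (interior v \<alpha>)"
  by (auto simp: homogeneous_def interior_def)

text \<open>The sign that a vector picks up when it moves past the first factor of a wedge product.\<close>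

definition grading_sign :: "'t form \<Rightarrow> 't form" where
  "grading_sign \<alpha> vs = (-1) ^ length vs * \<alpha> vs"

lemma grading_sign_homogeneous: "homogeneous k \<alpha> \<Longrightarrow> grading_sign \<alpha> = (\<lambda>vs. (-1) ^ k * \<alpha> vs)"
  unfolding grading_sign_def homogeneous_def by (rule ext) (metis mult_zero_right)

lemma Pow_lessThan_Suc_shift:
  "Pow {..<Suc n} = (\<lambda>S. insert 0 (Suc ` S)) ` Pow {..<n} \<union> (\<lambda>S. Suc ` S) ` Pow {..<n}"
proof -
  have "{..<Suc n} = insert 0 (Suc ` {..<n})" by (rule lessThan_Suc_eq_insert_0)
  then have "Pow {..<Suc n} = insert 0 ` Pow (Suc ` {..<n}) \<union> Pow (Suc ` {..<n})"
    by (simp add: Pow_insert Un_commute)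
  also have "Pow (Suc ` {..<n}) = (\<lambda>S. Suc ` S) ` Pow {..<n}"
    by (rule image_Pow_surj[symmetric]) simp
  finally show ?thesis by (simp add: image_image)
qed

lemma inversions_insert_0:
  "{(i, j). i \<in> insert 0 (Suc ` S) \<and> j \<in> {..<Suc n} - insert 0 (Suc ` S) \<and> j < i}
   = map_prod Suc Suc ` {(i, j). i \<in> S \<and> j \<in> {..<n} - S \<and> j < i}" (is "?L = ?R")
proof (rule set_eqI)
  fix x :: "nat \<times> nat"
  obtain i j where x: "x = (i, j)" by (cases x)
  show "x \<in> ?L \<longleftrightarrow> x \<in> ?R" unfolding x by (cases i; cases j) (auto simp: image_iff)
qed

lemma inversions_shift:
  "{(i, j). i \<in> Suc ` S \<and> j \<in> {..<Suc n} - Suc ` S \<and> j < i}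
   = map_prod Suc Suc ` {(i, j). i \<in> S \<and> j \<in> {..<n} - S \<and> j < i} \<union> (\<lambda>i. (Suc i, 0)) ` S" (is "?L = ?R")
proof (rule set_eqI)
  fix x :: "nat \<times> nat"
  obtain i j where x: "x = (i, j)" by (cases x)
  show "x \<in> ?L \<longleftrightarrow> x \<in> ?R" unfolding x by (cases i; cases j) (auto simp: image_iff)
qed

lemma wedge_Nil: "wedge \<alpha> \<beta> [] = \<alpha> [] * \<beta> []"
  by (simp add: wedge_def)

text \<open>Contraction is a graded derivation of the wedge product. Since \<^term>\<open>vs\<close> is arbitrary, this turns the sum
  over shuffles into a recursion on the list of arguments, and all later facts on wedge products
  come from it.\<close>

lemma wedge_Cons:
  "wedge \<alpha> \<beta> (v # vs) = wedge (interior v \<alpha>) \<beta> vs + wedge (grading_sign \<alpha>) (interior v \<beta>) vs"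
proof -
  define n where "n = length vs"
  define I :: "nat \<Rightarrow> nat set \<Rightarrow> (nat \<times> nat) set"
    where "I m S = {(i, j). i \<in> S \<and> j \<in> {..<m} - S \<and> j < i}" for m S
  define t where "t S = (-1) ^ card (I (Suc n) S) * \<alpha> (nths (v # vs) S) * \<beta> (nths (v # vs) (- S))" for S
  have inj: "inj_on (\<lambda>S. insert 0 (Suc ` S)) (Pow {..<n})" "inj_on (\<lambda>S. Suc ` S) (Pow {..<n})"
  proof -
    have "S = {j. Suc j \<in> insert 0 (Suc ` S)}" for S by auto
    then show "inj_on (\<lambda>S. insert 0 (Suc ` S)) (Pow {..<n})" by (metis inj_onI)
    have "S = {j. Suc j \<in> Suc ` S}" for S by auto
    then show "inj_on (\<lambda>S. Suc ` S) (Pow {..<n})" by (metis inj_onI)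
  qed
  have fin: "finite (I n S)" "finite S" if "S \<subseteq> {..<n}" for S
  proof -
    show fS: "finite S" using that by (rule finite_subset) simp
    have "I n S \<subseteq> S \<times> {..<n}" by (auto simp: I_def)
    then show "finite (I n S)" by (rule finite_subset) (simp add: fS)
  qed
  \<comment> \<open>The first argument goes to \<^term>\<open>\<alpha>\<close>, in front of everything, and creates no inversion.\<close>
  have first: "t (insert 0 (Suc ` S)) = (-1) ^ card (I n S) * interior v \<alpha> (nths vs S) * \<beta> (nths vs (- S))"
    if "S \<subseteq> {..<n}" for S
  proof -
    have "card (I (Suc n) (insert 0 (Suc ` S))) = card (I n S)"
      unfolding I_def inversions_insert_0 by (intro card_image) (simp add: inj_on_def)
    moreover have "{j. Suc j \<in> insert 0 (Suc ` S)} = S" "{j. Suc j \<in> - insert 0 (Suc ` S)} = - S" by auto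
    ultimately show ?thesis by (simp add: t_def nths_Cons interior_def)
  qed
  \<comment> \<open>The first argument goes to \<^term>\<open>\<beta>\<close> and is inverted with each argument of \<^term>\<open>\<alpha>\<close>.\<close>
  have second: "t (Suc ` S) = (-1) ^ card (I n S) * grading_sign \<alpha> (nths vs S) * interior v \<beta> (nths vs (- S))"
    if "S \<subseteq> {..<n}" for S
  proof -
    have "card (I (Suc n) (Suc ` S)) = card (map_prod Suc Suc ` I n S) + card ((\<lambda>i. (Suc i, 0::nat)) ` S)"
      unfolding I_def inversions_shift using fin[OF that]
      by (intro card_Un_disjoint) (auto simp: I_def)
    also have "\<dots> = card (I n S) + card S"
    proof -
      have "inj_on (map_prod Suc Suc) (I n S)" "inj_on (\<lambda>i. (Suc i, 0::nat)) S"
        by (auto simp: inj_on_def)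
      then show ?thesis by (simp add: card_image)
    qed
    finally have "card (I (Suc n) (Suc ` S)) = card (I n S) + card S" .
    moreover have "{j. Suc j \<in> Suc ` S} = S" "{j. Suc j \<in> - Suc ` S} = - S" by auto
    moreover have "length (nths vs S) = card S"
    proof -
      have "{i. i < length vs \<and> i \<in> S} = S" using that by (auto simp: n_def)
      then show ?thesis by (simp add: length_nths)
    qed
    ultimately show ?thesis
      by (simp add: t_def nths_Cons interior_def grading_sign_def power_add)
  qed
  have "wedge \<alpha> \<beta> (v # vs) = sum t (Pow {..<Suc n})"
    by (simp add: wedge_def t_def I_def n_def)
  also have "\<dots> = sum t ((\<lambda>S. insert 0 (Suc ` S)) ` Pow {..<n}) + sum t ((\<lambda>S. Suc ` S) ` Pow {..<n})"
    unfolding Pow_lessThan_Suc_shift by (rule sum.union_disjoint) auto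
  also have "\<dots> = (\<Sum>S\<in>Pow {..<n}. t (insert 0 (Suc ` S))) + (\<Sum>S\<in>Pow {..<n}. t (Suc ` S))"
    by (simp add: sum.reindex inj)
  also have "\<dots> = wedge (interior v \<alpha>) \<beta> vs + wedge (grading_sign \<alpha>) (interior v \<beta>) vs"
    unfolding wedge_def n_def[symmetric] I_def[symmetric]
    by (intro arg_cong2[of _ _ _ _ "(+)"] sum.cong refl) (simp_all add: first second)
  finally show ?thesis .
qed

lemma wedge_add_right: "wedge \<alpha> (\<beta> + \<gamma>) = wedge \<alpha> \<beta> + wedge \<alpha> \<gamma>"
  by (rule ext) (simp add: wedge_def algebra_simps sum.distrib)
lemma wedge_add_left: "wedge (\<beta> + \<gamma>) \<alpha> = wedge \<beta> \<alpha> + wedge \<gamma> \<alpha>"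
  by (rule ext) (simp add: wedge_def algebra_simps sum.distrib)
lemma wedge_scale_right: "wedge \<alpha> (\<lambda>vs. c * \<beta> vs) = (\<lambda>vs. c * wedge \<alpha> \<beta> vs)"
  by (rule ext) (simp add: wedge_def sum_distrib_left mult_ac)
lemma wedge_scale_left: "wedge (\<lambda>vs. c * \<alpha> vs) \<beta> = (\<lambda>vs. c * wedge \<alpha> \<beta> vs)"
  by (rule ext) (simp add: wedge_def sum_distrib_left mult_ac)
lemma wedge_uminus_right: "wedge \<alpha> (- \<beta>) = - wedge \<alpha> \<beta>"
  by (rule ext) (simp add: wedge_def sum_negf)
lemma wedge_uminus_left: "wedge (- \<alpha>) \<beta> = - wedge \<alpha> \<beta>"
  by (rule ext) (simp add: wedge_def sum_negf)
lemma wedge_diff_right: "wedge \<alpha> (\<beta> - \<gamma>) = wedge \<alpha> \<beta> - wedge \<alpha> \<gamma>"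
  by (rule ext) (simp add: wedge_def algebra_simps sum_subtractf)
lemma wedge_diff_left: "wedge (\<beta> - \<gamma>) \<alpha> = wedge \<beta> \<alpha> - wedge \<gamma> \<alpha>"
  by (rule ext) (simp add: wedge_def algebra_simps sum_subtractf)
lemma wedge_zero_left: "wedge 0 \<alpha> = 0"
  by (rule ext) (simp add: wedge_def)
lemma wedge_zero_right: "wedge \<alpha> 0 = 0"
  by (rule ext) (simp add: wedge_def)
lemma wedge_scaleR_right: "wedge \<alpha> (c *\<^sub>R \<beta>) = c *\<^sub>R wedge \<alpha> \<beta>"
  by (rule ext) (simp add: wedge_def scaleR_fun_def scaleR_sum_right)
lemma wedge_scaleR_left: "wedge (c *\<^sub>R \<alpha>) \<beta> = c *\<^sub>R wedge \<alpha> \<beta>"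
  by (rule ext) (simp add: wedge_def scaleR_fun_def scaleR_sum_right)

lemma wedge_homogeneous0:
  assumes "homogeneous 0 \<alpha>" shows "wedge \<alpha> \<beta> vs = \<alpha> [] * \<beta> vs"
proof (induction vs arbitrary: \<beta>)
  case Nil show ?case by (rule wedge_Nil)
next
  case (Cons v vs)
  have "interior v \<alpha> = 0" using homogeneousD[OF assms] by (auto simp: interior_def)
  then show ?case
    by (simp add: wedge_Cons grading_sign_homogeneous[OF assms] wedge_zero_left Cons interior_def)
qed

lemma wedge_1_Nil: "homogeneous 1 \<alpha> \<Longrightarrow> wedge \<alpha> \<beta> [] = 0"
  by (simp add: wedge_Nil homogeneousD)

lemma interior_wedge_1:
  assumes "homogeneous 1 \<alpha>"
  shows "interior v (wedge \<alpha> \<beta>) = (\<lambda>vs. \<alpha> [v] * \<beta> vs) - wedge \<alpha> (interior v \<beta>)"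
proof (rule ext)
  fix vs
  have *: "homogeneous 0 (interior v \<alpha>)" using assms homogeneous_interior[of 0 \<alpha>] by simp
  show "interior v (wedge \<alpha> \<beta>) vs = ((\<lambda>vs. \<alpha> [v] * \<beta> vs) - wedge \<alpha> (interior v \<beta>)) vs"
    by (simp add: interior_def[of v "wedge \<alpha> \<beta>"] wedge_Cons wedge_homogeneous0[OF *]
        grading_sign_homogeneous[OF assms] wedge_scale_left wedge_uminus_left[unfolded fun_Compl_def])
       (simp add: interior_def)
qed

lemma wedge_1_Cons:
  "homogeneous 1 \<alpha> \<Longrightarrow> wedge \<alpha> \<beta> (v # vs) = \<alpha> [v] * \<beta> vs - wedge \<alpha> (interior v \<beta>) vs"
  using fun_cong[OF interior_wedge_1[of \<alpha> v \<beta>], of vs] by (simp add: interior_def)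

lemma interior_wedge_2:
  assumes "homogeneous 2 \<alpha>"
  shows "interior v (wedge \<alpha> \<beta>) = wedge (interior v \<alpha>) \<beta> + wedge \<alpha> (interior v \<beta>)"
  by (rule ext) (simp add: interior_def[of v "wedge \<alpha> \<beta>"] wedge_Cons grading_sign_homogeneous[OF assms])

lemma wedge_2_Cons:
  "homogeneous 2 \<alpha> \<Longrightarrow> wedge \<alpha> \<beta> (v # vs) = wedge (interior v \<alpha>) \<beta> vs + wedge \<alpha> (interior v \<beta>) vs"
  using fun_cong[OF interior_wedge_2[of \<alpha> v \<beta>], of vs] by (simp add: interior_def)

lemma homogeneous_wedge:
  assumes "homogeneous k \<alpha>" "homogeneous l \<beta>" shows "homogeneous (k + l) (wedge \<alpha> \<beta>)"
  unfolding homogeneous_def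
proof (intro allI impI)
  fix vs assume "wedge \<alpha> \<beta> vs \<noteq> 0"
  then obtain S where "\<alpha> (nths vs S) * \<beta> (nths vs (- S)) \<noteq> 0"
    unfolding wedge_def by (metis (no_types, lifting) mult_eq_0_iff sum.neutral)
  then have *: "length (nths vs S) = k" "length (nths vs (- S)) = l"
    using assms by (auto simp: homogeneous_def)
  have "card ({i. i < length vs \<and> i \<in> S} \<union> {i. i < length vs \<and> i \<in> - S})
      = card {i. i < length vs \<and> i \<in> S} + card {i. i < length vs \<and> i \<in> - S}"
    by (rule card_Un_disjoint) auto
  moreover have "{i. i < length vs \<and> i \<in> S} \<union> {i. i < length vs \<and> i \<in> - S} = {..<length vs}"
    by auto
  ultimately show "length vs = k + l" using * by (simp add: length_nths)
qed

lemma grading_sign_interior: "interior v (grading_sign \<alpha>) = - grading_sign (interior v \<alpha>)"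
  by (rule ext) (simp add: interior_def grading_sign_def)

lemma grading_sign_wedge_1:
  assumes "homogeneous 1 \<alpha>" shows "grading_sign (wedge \<alpha> \<beta>) = - wedge \<alpha> (grading_sign \<beta>)"
proof (rule ext)
  fix vs show "grading_sign (wedge \<alpha> \<beta>) vs = (- wedge \<alpha> (grading_sign \<beta>)) vs"
  proof (induction vs arbitrary: \<beta>)
    case Nil show ?case by (simp add: grading_sign_def wedge_1_Nil[OF assms])
  next
    case (Cons v vs)
    show ?case using Cons[of "interior v \<beta>"]
      by (simp add: wedge_1_Cons[OF assms] grading_sign_interior wedge_uminus_right)
         (simp add: grading_sign_def wedge_1_Cons[OF assms] algebra_simps)
  qed
qed

text \<open>Associativity is only stated for a 1-form as first factor. This covers the products of 1-forms of
  which the forms on a frame are built.\<close>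

lemma wedge_1_assoc:
  assumes "homogeneous 1 \<alpha>" shows "wedge (wedge \<alpha> \<beta>) \<gamma> = wedge \<alpha> (wedge \<beta> \<gamma>)"
proof (rule ext)
  fix vs show "wedge (wedge \<alpha> \<beta>) \<gamma> vs = wedge \<alpha> (wedge \<beta> \<gamma>) vs"
  proof (induction vs arbitrary: \<beta> \<gamma>)
    case Nil show ?case by (simp add: wedge_Nil wedge_1_Nil[OF assms] homogeneousD[OF assms])
  next
    case (Cons v vs)
    have "interior v (wedge \<beta> \<gamma>) = wedge (interior v \<beta>) \<gamma> + wedge (grading_sign \<beta>) (interior v \<gamma>)"
      by (rule ext) (simp add: interior_def[of v "wedge \<beta> \<gamma>"] wedge_Cons)
    then show ?case
      by (simp add: wedge_1_Cons[OF assms] wedge_Cons[of "wedge \<alpha> \<beta>"] interior_wedge_1[OF assms]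
          grading_sign_wedge_1[OF assms] wedge_diff_left wedge_scale_left wedge_add_right wedge_uminus_left Cons)
  qed
qed

definition skew :: "'t form \<Rightarrow> bool" where
  "skew \<alpha> \<longleftrightarrow> (\<forall>xs u v ys. \<alpha> (xs @ u # v # ys) = - \<alpha> (xs @ v # u # ys))"

lemma skewD: "skew \<alpha> \<Longrightarrow> \<alpha> (xs @ u # v # ys) = - \<alpha> (xs @ v # u # ys)"
  unfolding skew_def by blast

lemma skewI: "(\<And>xs u v ys. \<alpha> (xs @ u # v # ys) = - \<alpha> (xs @ v # u # ys)) \<Longrightarrow> skew \<alpha>"
  unfolding skew_def by blast

lemma skew_add:
  assumes "skew \<alpha>" "skew \<beta>" shows "skew (\<alpha> + \<beta>)"
proof (rule skewI)
  fix xs u v ys show "(\<alpha> + \<beta>) (xs @ u # v # ys) = - (\<alpha> + \<beta>) (xs @ v # u # ys)"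
    using skewD[OF assms(1), of xs u v ys] skewD[OF assms(2), of xs u v ys] by simp
qed

lemma skew_diff:
  assumes "skew \<alpha>" "skew \<beta>" shows "skew (\<alpha> - \<beta>)"
proof (rule skewI)
  fix xs u v ys show "(\<alpha> - \<beta>) (xs @ u # v # ys) = - (\<alpha> - \<beta>) (xs @ v # u # ys)"
    using skewD[OF assms(1), of xs u v ys] skewD[OF assms(2), of xs u v ys] by simp
qed

lemma skew_scaleR:
  assumes "skew \<alpha>" shows "skew (c *\<^sub>R \<alpha>)"
proof (rule skewI)
  fix xs u v ys show "(c *\<^sub>R \<alpha>) (xs @ u # v # ys) = - (c *\<^sub>R \<alpha>) (xs @ v # u # ys)"
    using skewD[OF assms, of xs u v ys] by (simp add: scaleR_fun_def)
qed

lemma skew_interior: "skew \<alpha> \<Longrightarrow> skew (interior v \<alpha>)"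
  unfolding skew_def interior_def by (metis append_Cons)

lemma interior_interior: "skew \<alpha> \<Longrightarrow> interior u (interior v \<alpha>) = - interior v (interior u \<alpha>)"
  by (rule ext) (use skewD[of \<alpha> "[]" v u] in \<open>simp add: interior_def\<close>)

lemma skew_wedge_1:
  assumes \<alpha>: "homogeneous 1 \<alpha>" and "skew \<beta>" shows "skew (wedge \<alpha> \<beta>)"
proof -
  have "wedge \<alpha> \<beta> (xs @ u # v # ys) = - wedge \<alpha> \<beta> (xs @ v # u # ys)" for xs u v ys
    using \<open>skew \<beta>\<close>
  proof (induction xs arbitrary: \<beta>)
    case Nil
    show ?case
      by (simp add: wedge_1_Cons[OF \<alpha>] interior_interior[OF Nil, of u v] wedge_uminus_right)
         (simp add: interior_def algebra_simps)
  next
    case (Cons x xs)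
    show ?case
      using Cons.IH[OF skew_interior[OF Cons.prems]] skewD[OF Cons.prems, of xs u v ys]
      by (simp add: wedge_1_Cons[OF \<alpha>])
  qed
  then show ?thesis unfolding skew_def by blast
qed

lemma skew_wedge_2:
  assumes "homogeneous 2 \<alpha>" "skew \<alpha>" and "skew \<beta>" shows "skew (wedge \<alpha> \<beta>)"
proof -
  have \<alpha>: "homogeneous 1 (interior v \<alpha>)" for v
    using assms(1) homogeneous_interior[of 1] by (simp add: numeral_2_eq_2)
  have "wedge \<alpha> \<beta> (xs @ u # v # ys) = - wedge \<alpha> \<beta> (xs @ v # u # ys)" for xs u v ys
    using \<open>skew \<beta>\<close>
  proof (induction xs arbitrary: \<beta>)
    case Nil
    have "\<alpha> [u, v] = - \<alpha> [v, u]" using skewD[OF assms(2), of "[]" u v "[]"] by simp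
    then show ?case
      by (simp add: wedge_1_Cons[OF \<alpha>] wedge_2_Cons[OF assms(1)] interior_interior[OF Nil, of u v] wedge_uminus_right)
         (simp add: interior_def algebra_simps)
  next
    case (Cons x xs)
    have "skew (wedge (interior x \<alpha>) \<beta>)" by (rule skew_wedge_1[OF \<alpha> Cons.prems])
    then show ?case
      using Cons.IH[OF skew_interior[OF Cons.prems]] skewD[of _ xs u v ys]
      by (simp add: wedge_2_Cons[OF assms(1)])
  qed
  then show ?thesis unfolding skew_def by blast
qed

lemma wedge_1_anticommute:
  assumes "homogeneous 1 \<alpha>" "homogeneous 1 \<beta>"
  shows "wedge \<alpha> (wedge \<beta> \<gamma>) = - wedge \<beta> (wedge \<alpha> \<gamma>)"
proof (rule ext)
  fix vs show "wedge \<alpha> (wedge \<beta> \<gamma>) vs = (- wedge \<beta> (wedge \<alpha> \<gamma>)) vs"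
  proof (induction vs arbitrary: \<gamma>)
    case Nil show ?case using assms by (simp add: wedge_1_Nil)
  next
    case (Cons v vs)
    show ?case using assms Cons[of "interior v \<gamma>"]
      by (simp add: wedge_1_Cons interior_wedge_1 wedge_diff_right wedge_scale_right)
  qed
qed

lemma wedge_2_1_commute:
  assumes "homogeneous 2 \<alpha>" "homogeneous 1 \<beta>"
  shows "wedge \<alpha> (wedge \<beta> \<gamma>) = wedge \<beta> (wedge \<alpha> \<gamma>)"
proof (rule ext)
  have \<alpha>: "homogeneous 1 (interior v \<alpha>)" for v
    using assms(1) homogeneous_interior[of 1] by (simp add: numeral_2_eq_2)
  fix vs show "wedge \<alpha> (wedge \<beta> \<gamma>) vs = wedge \<beta> (wedge \<alpha> \<gamma>) vs"
  proof (induction vs arbitrary: \<gamma>)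
    case Nil show ?case using assms by (simp add: wedge_1_Nil wedge_Nil homogeneousD)
  next
    case (Cons v vs)
    show ?case using assms(2) Cons[of "interior v \<gamma>"] fun_cong[OF wedge_1_anticommute[OF \<alpha>[of v] assms(2), of \<gamma>], of vs]
      by (simp add: wedge_1_Cons wedge_2_Cons[OF assms(1)] interior_wedge_1 interior_wedge_2[OF assms(1)] wedge_diff_right wedge_add_right wedge_scale_right)
  qed
qed

section \<open>Powers of a 2-form\<close>

lemma wedge_power_0: "wedge_power \<alpha> 0 = unit_form"
  by (simp add: wedge_power_def)
lemma wedge_power_Suc: "wedge_power \<alpha> (Suc n) = wedge \<alpha> (wedge_power \<alpha> n)"
  by (simp add: wedge_power_def)

text \<open>The Leibniz rule gives \<open>n + 1\<close> terms, which agree because an even form commutes with the 1-form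
  \<open>i\<^sub>v \<alpha>\<close>. Evaluated on a list this is the expansion of a Pfaffian along its first row.\<close>

lemma interior_wedge_power:
  assumes "homogeneous 2 \<alpha>"
  shows "interior v (wedge_power \<alpha> (Suc n)) = (\<lambda>vs. of_nat (Suc n) * wedge (interior v \<alpha>) (wedge_power \<alpha> n) vs)"
proof (induction n)
  case 0
  have "interior v (unit_form :: 'a form) = 0" by (rule ext) (simp add: interior_def unit_form_def)
  then show ?case by (simp add: wedge_power_Suc wedge_power_0 interior_wedge_2[OF assms] wedge_zero_right)
next
  case (Suc n)
  have \<alpha>: "homogeneous 1 (interior v \<alpha>)" for v
    using assms(1) homogeneous_interior[of 1] by (simp add: numeral_2_eq_2)
  have "interior v (wedge_power \<alpha> (Suc (Suc n)))
      = wedge (interior v \<alpha>) (wedge_power \<alpha> (Suc n)) + wedge \<alpha> (interior v (wedge_power \<alpha> (Suc n)))"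
    by (subst wedge_power_Suc) (rule interior_wedge_2[OF assms])
  also have "\<dots> = wedge (interior v \<alpha>) (wedge_power \<alpha> (Suc n))
      + (\<lambda>vs. of_nat (Suc n) * wedge (interior v \<alpha>) (wedge_power \<alpha> (Suc n)) vs)"
    unfolding Suc wedge_scale_right wedge_2_1_commute[OF assms \<alpha>] wedge_power_Suc[symmetric] ..
  finally show ?case by (simp add: fun_eq_iff algebra_simps)
qed

lemma wedge_power_Cons:
  assumes "homogeneous 2 \<alpha>"
  shows "wedge_power \<alpha> (Suc n) (v # vs) = of_nat (Suc n) * wedge (interior v \<alpha>) (wedge_power \<alpha> n) vs"
  using fun_cong[OF interior_wedge_power[OF assms, of v n], of vs] by (simp add: interior_def)

lemma skew_unit_form: "skew unit_form"
  by (simp add: skew_def unit_form_def)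

lemma skew_wedge_power: "homogeneous 2 \<alpha> \<Longrightarrow> skew \<alpha> \<Longrightarrow> skew (wedge_power \<alpha> n)"
  by (induction n) (simp_all add: wedge_power_0 wedge_power_Suc skew_unit_form skew_wedge_2)

text \<open>Pfaffians of skew matrices of size 4, 6 and 8, expanded along the first row. Only entries whose
  row precedes the column in the argument list occur.\<close>

definition pf4 :: "('i \<Rightarrow> 'i \<Rightarrow> complex) \<Rightarrow> 'i \<Rightarrow> 'i \<Rightarrow> 'i \<Rightarrow> 'i \<Rightarrow> complex" where
  "pf4 f a b c d = f a b * f c d - f a c * f b d + f a d * f b c"

definition pf6 :: "('i \<Rightarrow> 'i \<Rightarrow> complex) \<Rightarrow> 'i \<Rightarrow> 'i \<Rightarrow> 'i \<Rightarrow> 'i \<Rightarrow> 'i \<Rightarrow> 'i \<Rightarrow> complex" where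
  "pf6 f a b c d e g = f a b * pf4 f c d e g - f a c * pf4 f b d e g + f a d * pf4 f b c e g
     - f a e * pf4 f b c d g + f a g * pf4 f b c d e"

definition pf8 :: "('i \<Rightarrow> 'i \<Rightarrow> complex) \<Rightarrow> 'i \<Rightarrow> 'i \<Rightarrow> 'i \<Rightarrow> 'i \<Rightarrow> 'i \<Rightarrow> 'i \<Rightarrow> 'i \<Rightarrow> 'i \<Rightarrow> complex" where
  "pf8 f a b c d e g h i = f a b * pf6 f c d e g h i - f a c * pf6 f b d e g h i
     + f a d * pf6 f b c e g h i - f a e * pf6 f b c d g h i + f a g * pf6 f b c d e h i
     - f a h * pf6 f b c d e g i + f a i * pf6 f b c d e g h"

lemma wedge_power_pf:
  fixes \<alpha> :: "'t form"
  assumes "homogeneous 2 \<alpha>"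
  defines "f \<equiv> \<lambda>u v. \<alpha> [u, v]"
  shows "wedge_power \<alpha> 2 [a, b, c, d] = 2 * pf4 f a b c d"
    and "wedge_power \<alpha> 3 [a, b, c, d, e, g] = 6 * pf6 f a b c d e g"
    and "wedge_power \<alpha> 4 [a, b, c, d, e, g, h, i] = 24 * pf8 f a b c d e g h i"
proof -
  have \<alpha>: "homogeneous 1 (interior v \<alpha>)" for v
    using assms(1) homogeneous_interior[of 1] by (simp add: numeral_2_eq_2)
  note s = wedge_1_Cons[OF \<alpha>] wedge_1_Nil[OF \<alpha>] interior_def
  have 1: "wedge_power \<alpha> (Suc 0) [a, b] = f a b" for a b
    using wedge_power_Cons[OF assms(1), of 0 a "[b]"] by (simp add: wedge_power_0 s unit_form_def f_def)
  show 2: "wedge_power \<alpha> 2 [a, b, c, d] = 2 * pf4 f a b c d" for a b c d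
    using wedge_power_Cons[OF assms(1), of 1 a "[b, c, d]"] by (simp add: s 1 pf4_def numeral_2_eq_2[symmetric]) (simp add: f_def algebra_simps)
  show 3: "wedge_power \<alpha> 3 [a, b, c, d, e, g] = 6 * pf6 f a b c d e g" for a b c d e g
    using wedge_power_Cons[OF assms(1), of 2 a "[b, c, d, e, g]"] by (simp add: s 2 pf6_def) (simp add: f_def algebra_simps)
  show "wedge_power \<alpha> 4 [a, b, c, d, e, g, h, i] = 24 * pf8 f a b c d e g h i"
    using wedge_power_Cons[OF assms(1), of 3 a "[b, c, d, e, g, h, i]"] by (simp add: s 3 pf8_def) (simp add: f_def algebra_simps)
qed

section \<open>Indices and index lists\<close>

lemma UNIV_8: "(UNIV :: 8 set) = set [0, 1, 2, 3, 4, 5, 6, 7]"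
proof -
  have "card (set [0, 1, 2, 3, 4, 5, 6, 7] :: 8 set) = CARD(8)" by simp
  then show ?thesis using card_subset_eq[of "UNIV :: 8 set" "set [0, 1, 2, 3, 4, 5, 6, 7]"] by simp
qed

lemma sum_8: "(\<Sum>i\<in>UNIV. g (i::8)) = g 0 + g 1 + g 2 + g 3 + g 4 + g 5 + g 6 + g 7"
  unfolding UNIV_8 by (simp add: add.assoc)

lemma all_8: "(\<forall>i::8. P i) \<longleftrightarrow> P 0 \<and> P 1 \<and> P 2 \<and> P 3 \<and> P 4 \<and> P 5 \<and> P 6 \<and> P 7"
proof -
  have "(\<forall>i::8. P i) \<longleftrightarrow> (\<forall>i\<in>UNIV. P i)" by simp
  then show ?thesis unfolding UNIV_8 by simp
qed

lemma sum_7: "(\<Sum>i\<in>UNIV-{0}. g (i::8)) = g 1 + g 2 + g 3 + g 4 + g 5 + g 6 + (g 7 :: 'a::ab_group_add)"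
  by (simp add: sum_diff1 sum_8)

lemma nonzero_index_cases:
  assumes "P 1" "P 2" "P 3" "P 4" "P 5" "P 6" "P 7" "(k::8) \<noteq> 0" shows "P k"
proof -
  have "\<forall>k::8. k \<noteq> 0 \<longrightarrow> P k" using assms(1-7) by (simp add: all_8)
  then show ?thesis using assms(8) by blast
qed

text \<open>A table that lets the simplifier compare indices without arithmetic modulo 8.\<close>

lemma eq_8:
  "(0::8) = 1 \<longleftrightarrow> False" "(0::8) = 2 \<longleftrightarrow> False" "(0::8) = 3 \<longleftrightarrow> False" "(0::8) = 4 \<longleftrightarrow> False"
  "(0::8) = 5 \<longleftrightarrow> False" "(0::8) = 6 \<longleftrightarrow> False" "(0::8) = 7 \<longleftrightarrow> False" "(1::8) = 0 \<longleftrightarrow> False"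
  "(1::8) = 2 \<longleftrightarrow> False" "(1::8) = 3 \<longleftrightarrow> False" "(1::8) = 4 \<longleftrightarrow> False" "(1::8) = 5 \<longleftrightarrow> False"
  "(1::8) = 6 \<longleftrightarrow> False" "(1::8) = 7 \<longleftrightarrow> False" "(2::8) = 0 \<longleftrightarrow> False" "(2::8) = 1 \<longleftrightarrow> False"
  "(2::8) = 3 \<longleftrightarrow> False" "(2::8) = 4 \<longleftrightarrow> False" "(2::8) = 5 \<longleftrightarrow> False" "(2::8) = 6 \<longleftrightarrow> False"
  "(2::8) = 7 \<longleftrightarrow> False" "(3::8) = 0 \<longleftrightarrow> False" "(3::8) = 1 \<longleftrightarrow> False" "(3::8) = 2 \<longleftrightarrow> False"
  "(3::8) = 4 \<longleftrightarrow> False" "(3::8) = 5 \<longleftrightarrow> False" "(3::8) = 6 \<longleftrightarrow> False" "(3::8) = 7 \<longleftrightarrow> False"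
  "(4::8) = 0 \<longleftrightarrow> False" "(4::8) = 1 \<longleftrightarrow> False" "(4::8) = 2 \<longleftrightarrow> False" "(4::8) = 3 \<longleftrightarrow> False"
  "(4::8) = 5 \<longleftrightarrow> False" "(4::8) = 6 \<longleftrightarrow> False" "(4::8) = 7 \<longleftrightarrow> False" "(5::8) = 0 \<longleftrightarrow> False"
  "(5::8) = 1 \<longleftrightarrow> False" "(5::8) = 2 \<longleftrightarrow> False" "(5::8) = 3 \<longleftrightarrow> False" "(5::8) = 4 \<longleftrightarrow> False"
  "(5::8) = 6 \<longleftrightarrow> False" "(5::8) = 7 \<longleftrightarrow> False" "(6::8) = 0 \<longleftrightarrow> False" "(6::8) = 1 \<longleftrightarrow> False"
  "(6::8) = 2 \<longleftrightarrow> False" "(6::8) = 3 \<longleftrightarrow> False" "(6::8) = 4 \<longleftrightarrow> False" "(6::8) = 5 \<longleftrightarrow> False"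
  "(6::8) = 7 \<longleftrightarrow> False" "(7::8) = 0 \<longleftrightarrow> False" "(7::8) = 1 \<longleftrightarrow> False" "(7::8) = 2 \<longleftrightarrow> False"
  "(7::8) = 3 \<longleftrightarrow> False" "(7::8) = 4 \<longleftrightarrow> False" "(7::8) = 5 \<longleftrightarrow> False" "(7::8) = 6 \<longleftrightarrow> False"
  by simp_all

text \<open>\<open>peel is f js\<close> is the value of \<open>e\<^sup>i\<^sup>1 \<and> \<dots> \<and> e\<^sup>i\<^sup>r \<and> \<beta>\<close> on the frame vectors with indices
  \<^term>\<open>js\<close>, if \<^term>\<open>f\<close> gives the values of \<open>\<beta>\<close>: each index of \<^term>\<open>is\<close> is looked up and removed, with the sign
  of its position. It makes such values computable by rewriting.\<close>

primrec peel :: "'i list \<Rightarrow> ('i list \<Rightarrow> complex) \<Rightarrow> 'i list \<Rightarrow> complex" where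
  "peel [] f js = f js"
| "peel (i # is) f js = (if i \<in> set js
     then (-1) ^ length (takeWhile (\<lambda>j. j \<noteq> i) js) * peel is f (remove1 i js) else 0)"

lemma peel_cong: "(\<And>l. length l + length is = length js \<Longrightarrow> f l = g l) \<Longrightarrow> peel is f js = peel is g js"
proof (induction "is" arbitrary: js)
  case (Cons i "is")
  have "peel is f (remove1 i js) = peel is g (remove1 i js)" if "i \<in> set js"
    using that by (intro Cons.IH Cons.prems) (auto simp: length_remove1 dest: length_pos_if_in_set)
  then show ?case by simp
qed simp

text \<open>The case \<open>\<beta> = 1\<close>: the sign of the permutation between two lists of distinct indices, and 0 if they
  do not have the same entries.\<close>

abbreviation arrangement_sign :: "'i list \<Rightarrow> 'i list \<Rightarrow> complex" where
  "arrangement_sign is \<equiv> peel is (\<lambda>js. of_bool (js = []))"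

abbreviation indices :: "8 list" where "indices \<equiv> [0, 1, 2, 3, 4, 5, 6, 7]"

section \<open>The symmetric pair spin(7) in so(8)\<close>

definition phi_terms :: "(complex \<times> 8 \<times> 8 \<times> 8) list" where
  "phi_terms = [(1,1,2,3), (1,1,4,5), (1,1,6,7), (1,2,4,6), (-1,2,5,7), (-1,3,4,7), (-1,3,5,6)]"

definition star_phi_terms :: "(complex \<times> 8 \<times> 8 \<times> 8 \<times> 8) list" where
  "star_phi_terms = [(1,4,5,6,7), (1,2,3,6,7), (1,2,3,4,5), (1,1,3,5,7), (-1,1,3,4,6), (-1,1,2,5,6), (-1,1,2,4,7)]"

text \<open>The inner product of a 2-form with \<open>e\<^sup>0 \<and> e\<^sup>k + i(e\<^sub>k) \<phi>\<close>, in terms of the matrix of the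
  2-form. For \<open>k = 1, \<dots>, 7\<close> these forms span \<open>\<Lambda>\<^sup>2\<^sub>7\<close>.\<close>

definition coord2 :: "(8 \<Rightarrow> 8 \<Rightarrow> complex) \<Rightarrow> 8 \<Rightarrow> complex" where
  "coord2 f k = f 0 k + (\<Sum>(s,a,b,c)\<leftarrow>phi_terms.
     s * (of_bool (k = a) * f b c - of_bool (k = b) * f a c + of_bool (k = c) * f a b))"

text \<open>The inner product of a 4-form with \<open>e\<^sup>0 \<and> i(e\<^sub>k) *\<phi> - e\<^sup>k \<and> \<phi>\<close>, in terms of components. For
  \<open>k = 1, \<dots>, 7\<close> these forms span \<open>\<Lambda>\<^sup>4\<^sub>7\<close>. Components with a repeated index are left out, since they
  vanish by antisymmetry.\<close>

definition coord4 :: "(8 list \<Rightarrow> complex) \<Rightarrow> 8 \<Rightarrow> complex" where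
  "coord4 \<beta> k = (\<Sum>(s,a,b,c,d)\<leftarrow>star_phi_terms.
       s * (of_bool (k = a) * \<beta> [0,b,c,d] - of_bool (k = b) * \<beta> [0,a,c,d]
          + of_bool (k = c) * \<beta> [0,a,b,d] - of_bool (k = d) * \<beta> [0,a,b,c]))
     - (\<Sum>(s,a,b,c)\<leftarrow>phi_terms. s * (of_bool (k \<notin> {a, b, c}) * \<beta> [k,a,b,c]))"

lemma coord2_simps:
  "coord2 f 1 = f 0 1 + f 2 3 + f 4 5 + f 6 7"
  "coord2 f 2 = f 0 2 - f 1 3 + f 4 6 - f 5 7"
  "coord2 f 3 = f 0 3 + f 1 2 - f 4 7 - f 5 6"
  "coord2 f 4 = f 0 4 - f 1 5 - f 2 6 + f 3 7"
  "coord2 f 5 = f 0 5 + f 1 4 + f 2 7 + f 3 6"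
  "coord2 f 6 = f 0 6 - f 1 7 + f 2 4 - f 3 5"
  "coord2 f 7 = f 0 7 + f 1 6 - f 2 5 - f 3 4"
  by (simp_all add: coord2_def phi_terms_def)

lemma coord4_simps:
  "coord4 \<beta> 1 = \<beta> [0,3,5,7] - \<beta> [0,3,4,6] - \<beta> [0,2,5,6] - \<beta> [0,2,4,7] - \<beta> [1,2,4,6] + \<beta> [1,2,5,7] + \<beta> [1,3,4,7] + \<beta> [1,3,5,6]"
  "coord4 \<beta> 2 = \<beta> [0,3,6,7] + \<beta> [0,3,4,5] + \<beta> [0,1,5,6] + \<beta> [0,1,4,7] - \<beta> [2,1,4,5] - \<beta> [2,1,6,7] + \<beta> [2,3,4,7] + \<beta> [2,3,5,6]"
  "coord4 \<beta> 3 = - \<beta> [0,2,6,7] - \<beta> [0,2,4,5] - \<beta> [0,1,5,7] + \<beta> [0,1,4,6] - \<beta> [3,1,4,5] - \<beta> [3,1,6,7] - \<beta> [3,2,4,6] + \<beta> [3,2,5,7]"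
  "coord4 \<beta> 4 = \<beta> [0,5,6,7] + \<beta> [0,2,3,5] - \<beta> [0,1,3,6] - \<beta> [0,1,2,7] - \<beta> [4,1,2,3] - \<beta> [4,1,6,7] + \<beta> [4,2,5,7] + \<beta> [4,3,5,6]"
  "coord4 \<beta> 5 = - \<beta> [0,4,6,7] - \<beta> [0,2,3,4] + \<beta> [0,1,3,7] - \<beta> [0,1,2,6] - \<beta> [5,1,2,3] - \<beta> [5,1,6,7] - \<beta> [5,2,4,6] + \<beta> [5,3,4,7]"
  "coord4 \<beta> 6 = \<beta> [0,4,5,7] + \<beta> [0,2,3,7] + \<beta> [0,1,3,4] + \<beta> [0,1,2,5] - \<beta> [6,1,2,3] - \<beta> [6,1,4,5] + \<beta> [6,2,5,7] + \<beta> [6,3,4,7]"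
  "coord4 \<beta> 7 = - \<beta> [0,4,5,6] - \<beta> [0,2,3,6] - \<beta> [0,1,3,5] + \<beta> [0,1,2,4] - \<beta> [7,1,2,3] - \<beta> [7,1,4,5] - \<beta> [7,2,4,6] + \<beta> [7,3,5,6]"
  by (simp_all add: coord4_def star_phi_terms_def phi_terms_def)

text \<open>The matrix of \<open>e\<^sup>0 \<and> e\<^sup>k + i(e\<^sub>k) \<phi>\<close>, read off from the functional \<^const>\<open>coord2\<close> that it
  represents.\<close>

definition gamma_mat :: "8 \<Rightarrow> 8 \<Rightarrow> 8 \<Rightarrow> complex" where
  "gamma_mat k i j = coord2 (\<lambda>a b. of_bool (a = i \<and> b = j) - of_bool (a = j \<and> b = i)) k"

text \<open>Since the basis elements have square norm 4, this is 4 times the projection to \<open>\<Lambda>\<^sup>2\<^sub>7\<close>.\<close>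

definition part7 :: "(8 \<Rightarrow> 8 \<Rightarrow> complex) \<Rightarrow> 8 \<Rightarrow> 8 \<Rightarrow> complex" where
  "part7 f i j = (\<Sum>k\<in>UNIV - {0}. coord2 f k * gamma_mat k i j)"

definition bracket :: "(8 \<Rightarrow> 8 \<Rightarrow> complex) \<Rightarrow> (8 \<Rightarrow> 8 \<Rightarrow> complex) \<Rightarrow> 8 \<Rightarrow> 8 \<Rightarrow> complex" where
  "bracket f g i j = (\<Sum>m\<in>UNIV. f i m * g m j - g i m * f m j)"

abbreviation skew_matrix :: "(8 \<Rightarrow> 8 \<Rightarrow> complex) \<Rightarrow> bool" where
  "skew_matrix f \<equiv> \<forall>i j. f j i = - f i j"

lemma skew_matrix_entries:
  assumes "skew_matrix f"
  shows "f i i = 0"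
    "f 1 0 = - f 0 1" "f 2 0 = - f 0 2" "f 3 0 = - f 0 3" "f 4 0 = - f 0 4" "f 5 0 = - f 0 5"
    "f 6 0 = - f 0 6" "f 7 0 = - f 0 7" "f 2 1 = - f 1 2" "f 3 1 = - f 1 3" "f 4 1 = - f 1 4"
    "f 5 1 = - f 1 5" "f 6 1 = - f 1 6" "f 7 1 = - f 1 7" "f 3 2 = - f 2 3" "f 4 2 = - f 2 4"
    "f 5 2 = - f 2 5" "f 6 2 = - f 2 6" "f 7 2 = - f 2 7" "f 4 3 = - f 3 4" "f 5 3 = - f 3 5"
    "f 6 3 = - f 3 6" "f 7 3 = - f 3 7" "f 5 4 = - f 4 5" "f 6 4 = - f 4 6" "f 7 4 = - f 4 7"
    "f 6 5 = - f 5 6" "f 7 5 = - f 5 7" "f 7 6 = - f 6 7"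
proof -
  have "f i i = - f i i" using assms by blast
  then show "f i i = 0" by simp
qed (use assms in blast)+

lemma coord2_uminus: "coord2 (\<lambda>a b. - f a b) k = - coord2 f k"
  by (simp add: coord2_def phi_terms_def algebra_simps)

lemma skew_part7: "skew_matrix (part7 f)"
proof (intro allI)
  fix i j
  have "gamma_mat k j i = - gamma_mat k i j" for k
    unfolding gamma_mat_def coord2_uminus[symmetric] by simp
  then show "part7 f j i = - part7 f i j" by (simp add: part7_def sum_negf)
qed

lemmas gamma_mat_simps =
  coord2_simps[of "\<lambda>a b. of_bool (a = i \<and> b = j) - of_bool (a = j \<and> b = i)" for i j, folded gamma_mat_def]

lemma part7_entries:
  "part7 f 0 1 = coord2 f 1" "part7 f 0 2 = coord2 f 2" "part7 f 0 3 = coord2 f 3"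
  "part7 f 0 4 = coord2 f 4" "part7 f 0 5 = coord2 f 5" "part7 f 0 6 = coord2 f 6"
  "part7 f 0 7 = coord2 f 7" "part7 f 1 2 = coord2 f 3" "part7 f 1 3 = - coord2 f 2"
  "part7 f 1 4 = coord2 f 5" "part7 f 1 5 = - coord2 f 4" "part7 f 1 6 = coord2 f 7"
  "part7 f 1 7 = - coord2 f 6" "part7 f 2 3 = coord2 f 1" "part7 f 2 4 = coord2 f 6"
  "part7 f 2 5 = - coord2 f 7" "part7 f 2 6 = - coord2 f 4" "part7 f 2 7 = coord2 f 5"
  "part7 f 3 4 = - coord2 f 7" "part7 f 3 5 = - coord2 f 6" "part7 f 3 6 = coord2 f 5"
  "part7 f 3 7 = coord2 f 4" "part7 f 4 5 = coord2 f 1" "part7 f 4 6 = coord2 f 2"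
  "part7 f 4 7 = - coord2 f 3" "part7 f 5 6 = - coord2 f 3" "part7 f 5 7 = - coord2 f 2"
  "part7 f 6 7 = coord2 f 1"
  unfolding part7_def sum_7 gamma_mat_simps by simp_all

text \<open>Write \<open>so(8) = spin(7) \<oplus> m\<close> with \<open>m = \<Lambda>\<^sup>2\<^sub>7\<close>. This is a symmetric pair, that is
  \<open>[m, m] \<subseteq> spin(7)\<close>, so the \<open>m\<close>-part of \<open>[f, g]\<close> is that of
  \<open>[f, g\<^sub>m] + [f\<^sub>m, g]\<close>. The factor 4 comes from the normalisation of \<^const>\<open>part7\<close>. In coordinates it is a
  bilinear identity for each \<^term>\<open>k\<close>.\<close>

lemma coord2_bracket:
  assumes f: "skew_matrix f" and g: "skew_matrix g" and "k \<noteq> 0"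
  shows "4 * coord2 (bracket f g) k = coord2 (bracket f (part7 g)) k - coord2 (bracket g (part7 f)) k"
  by (rule nonzero_index_cases[OF _ _ _ _ _ _ _ \<open>k \<noteq> 0\<close>];
      simp only: coord2_simps bracket_def sum_8 part7_entries skew_matrix_entries[OF f]
        skew_matrix_entries[OF g] skew_matrix_entries[OF skew_part7];
      algebra)

text \<open>The projection of \<open>F \<and> F\<close> to \<open>\<Lambda>\<^sup>4\<^sub>7\<close> is a \<open>Spin(7)\<close>-equivariant quadratic map from \<open>spin(7) \<oplus> m\<close> to the
  7-dimensional representation. Such a map is unique up to a factor, since only \<open>spin(7) \<otimes> m\<close>
  contains that representation, and it is \<open>[F, F\<^sub>m]\<close>. The proof compares the coordinates.\<close>

lemma coord4_square:
  assumes f: "skew_matrix f" and "k \<noteq> 0"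
    and \<beta>: "\<And>a b c d. \<beta> [a, b, c, d] = pf4 f a b c d"
  shows "4 * coord4 \<beta> k = - coord2 (bracket f (part7 f)) k"
  by (rule nonzero_index_cases[OF _ _ _ _ _ _ _ \<open>k \<noteq> 0\<close>];
      simp only: coord4_simps \<beta> pf4_def
        coord2_simps bracket_def sum_8 part7_entries skew_matrix_entries[OF f]
        skew_matrix_entries[OF skew_part7];
      algebra)

lemma part7_eq_uminus:
  assumes "\<And>k. k \<noteq> 0 \<Longrightarrow> coord2 g k = - coord2 f k"
  shows "part7 g = (\<lambda>i j. - part7 f i j)"
  by (intro ext) (simp add: part7_def assms sum_negf)

lemma bracket_uminus_right: "bracket f (\<lambda>i j. - g i j) = (\<lambda>i j. - bracket f g i j)"
  by (intro ext) (simp add: bracket_def algebra_simps sum_subtractf sum.distrib sum_negf)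

text \<open>The heart of the argument. If \<open>f\<close> and \<open>g\<close> commute, the symmetric pair identity says that
  \<open>[f, g\<^sub>m]\<close> and \<open>[g, f\<^sub>m]\<close> have the same \<open>m\<close>-part; if moreover \<open>g\<^sub>m = - f\<^sub>m\<close>, these are
  \<open>- [f, f\<^sub>m]\<close> and \<open>- [g, g\<^sub>m]\<close>.\<close>

lemma coord4_eq_of_commuting:
  assumes "skew_matrix f" "skew_matrix g" "k \<noteq> 0"
    and comm: "\<And>i j. bracket f g i j = 0"
    and opp: "\<And>k. k \<noteq> 0 \<Longrightarrow> coord2 g k = - coord2 f k"
    and \<beta>: "\<And>a b c d. \<beta> [a, b, c, d] = pf4 f a b c d"
    and \<gamma>: "\<And>a b c d. \<gamma> [a, b, c, d] = pf4 g a b c d"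
  shows "coord4 \<beta> k = coord4 \<gamma> k"
proof -
  have pf: "part7 g = (\<lambda>i j. - part7 f i j)" "part7 f = (\<lambda>i j. - part7 g i j)"
    using part7_eq_uminus[of g f] opp by auto
  have "coord2 (bracket f g) k = 0"
    unfolding coord2_def comm by (simp add: phi_terms_def)
  then have 1: "coord2 (bracket f (part7 g)) k = coord2 (bracket g (part7 f)) k"
    using coord2_bracket[OF assms(1,2,3)] by simp
  have "4 * coord4 \<beta> k = - coord2 (bracket f (part7 f)) k" by (rule coord4_square[OF assms(1,3) \<beta>])
  also have "\<dots> = coord2 (bracket f (part7 g)) k"
    by (subst pf(2)) (simp add: bracket_uminus_right coord2_uminus)
  also have "\<dots> = coord2 (bracket g (part7 f)) k" by (rule 1)
  also have "\<dots> = - coord2 (bracket g (part7 g)) k"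
    by (subst pf(2)) (simp add: bracket_uminus_right coord2_uminus)
  also have "\<dots> = 4 * coord4 \<gamma> k" by (rule coord4_square[OF assms(2,3) \<gamma>, symmetric])
  finally show ?thesis by simp
qed

section \<open>The Pfaffian adjugate\<close>

text \<open>The matrix of \<open>* F\<^sup>3 / 6\<close>: its entries are the complementary Pfaffian minors. For an invertible matrix
  it is \<open>- Pf(f) f\<^sup>-\<^sup>1\<close>.\<close>

definition pf_adjugate :: "(8 \<Rightarrow> 8 \<Rightarrow> complex) \<Rightarrow> 8 \<Rightarrow> 8 \<Rightarrow> complex" where
  "pf_adjugate f i j = (if i = j then 0 else
     (let ks = filter (\<lambda>k. k \<noteq> i \<and> k \<noteq> j) indices in
      arrangement_sign indices (ks @ [i, j]) * pf6 f (ks!0) (ks!1) (ks!2) (ks!3) (ks!4) (ks!5)))"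

lemma pf_adjugate_entries:
  "pf_adjugate f 0 1 = pf6 f 2 3 4 5 6 7"
  "pf_adjugate f 0 2 = - pf6 f 1 3 4 5 6 7"
  "pf_adjugate f 0 3 = pf6 f 1 2 4 5 6 7"
  "pf_adjugate f 0 4 = - pf6 f 1 2 3 5 6 7"
  "pf_adjugate f 0 5 = pf6 f 1 2 3 4 6 7"
  "pf_adjugate f 0 6 = - pf6 f 1 2 3 4 5 7"
  "pf_adjugate f 0 7 = pf6 f 1 2 3 4 5 6"
  "pf_adjugate f 1 2 = pf6 f 0 3 4 5 6 7"
  "pf_adjugate f 1 3 = - pf6 f 0 2 4 5 6 7"
  "pf_adjugate f 1 4 = pf6 f 0 2 3 5 6 7"
  "pf_adjugate f 1 5 = - pf6 f 0 2 3 4 6 7"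
  "pf_adjugate f 1 6 = pf6 f 0 2 3 4 5 7"
  "pf_adjugate f 1 7 = - pf6 f 0 2 3 4 5 6"
  "pf_adjugate f 2 3 = pf6 f 0 1 4 5 6 7"
  "pf_adjugate f 2 4 = - pf6 f 0 1 3 5 6 7"
  "pf_adjugate f 2 5 = pf6 f 0 1 3 4 6 7"
  "pf_adjugate f 2 6 = - pf6 f 0 1 3 4 5 7"
  "pf_adjugate f 2 7 = pf6 f 0 1 3 4 5 6"
  "pf_adjugate f 3 4 = pf6 f 0 1 2 5 6 7"
  "pf_adjugate f 3 5 = - pf6 f 0 1 2 4 6 7"
  "pf_adjugate f 3 6 = pf6 f 0 1 2 4 5 7"
  "pf_adjugate f 3 7 = - pf6 f 0 1 2 4 5 6"
  "pf_adjugate f 4 5 = pf6 f 0 1 2 3 6 7"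
  "pf_adjugate f 4 6 = - pf6 f 0 1 2 3 5 7"
  "pf_adjugate f 4 7 = pf6 f 0 1 2 3 5 6"
  "pf_adjugate f 5 6 = pf6 f 0 1 2 3 4 7"
  "pf_adjugate f 5 7 = - pf6 f 0 1 2 3 4 6"
  "pf_adjugate f 6 7 = pf6 f 0 1 2 3 4 5"
  unfolding pf_adjugate_def by (simp_all add: Let_def)

lemma skew_pf_adjugate: "skew_matrix (pf_adjugate f)"
  unfolding all_8 pf_adjugate_def by (simp add: Let_def)

text \<open>The product of \<^term>\<open>f\<close> and its Pfaffian adjugate is the scalar \<open>- Pf(f)\<close> in either order: the off-diagonal
  entries are expansions of Pfaffians with a repeated row.\<close>

lemma bracket_pf_adjugate:
  assumes f: "skew_matrix f" shows "bracket f (pf_adjugate f) i j = 0"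
proof -
  have "\<forall>i j. bracket f (pf_adjugate f) i j = 0"
    unfolding all_8
    by (intro conjI; simp only: bracket_def sum_8 skew_matrix_entries[OF f] skew_matrix_entries[OF skew_pf_adjugate]
       pf_adjugate_entries pf6_def pf4_def; algebra)
  then show ?thesis by blast
qed

text \<open>Jacobi's identity for complementary minors, in its Pfaffian version, says that the 4-minors of the
  adjugate are \<open>Pf(f)\<close> times the complementary 4-minors of \<^term>\<open>f\<close>; in other words, the square of \<open>* F\<^sup>3 / 6\<close> is
  \<open>Pf(f)\<close> times \<open>* F\<^sup>2\<close>. The star disappears because \<open>\<Lambda>\<^sup>4\<^sub>7\<close> consists of self-dual forms.\<close>

lemma coord4_pf_adjugate:
  assumes f: "skew_matrix f" and "k \<noteq> 0"
    and \<beta>: "\<And>a b c d. \<beta> [a, b, c, d] = pf4 f a b c d"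
    and \<gamma>: "\<And>a b c d. \<gamma> [a, b, c, d] = pf4 (pf_adjugate f) a b c d"
  shows "coord4 \<gamma> k = pf8 f 0 1 2 3 4 5 6 7 * coord4 \<beta> k"
  by (rule nonzero_index_cases[OF _ _ _ _ _ _ _ \<open>k \<noteq> 0\<close>];
      simp only: coord4_simps \<beta> \<gamma> pf8_def pf6_def pf4_def
        skew_matrix_entries[OF f] skew_matrix_entries[OF skew_pf_adjugate] pf_adjugate_entries;
      algebra)

section \<open>Frame components and the Hodge star\<close>

text \<open>A product of two antisymmetric functions is not affected by a transposition of adjacent entries, and
  these generate all rearrangements. In this form the sums over subframes below lose their dependence
  on the order in which the indices are listed.\<close>

lemma swap_invariant_mset:
  assumes "\<And>xs u v ys. h (xs @ u # v # ys) = h (xs @ v # u # ys)"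
  shows "mset xs = mset ys \<Longrightarrow> h xs = h ys"
  using assms
proof (induction xs arbitrary: ys h)
  case Nil then show ?case by simp
next
  case (Cons x xs)
  have "x \<in> set ys" using Cons.prems(1) by (metis list.set_intros(1) mset_eq_setD)
  then obtain as bs where ys: "ys = as @ x # bs" by (meson split_list)
  have front: "h (as @ x # bs) = h (x # as @ bs)" for bs
  proof (induction as arbitrary: bs rule: rev_induct)
    case Nil show ?case by simp
  next
    case (snoc a as)
    have "h ((as @ [a]) @ x # bs) = h (as @ x # a # bs)" using Cons.prems(2)[of as a x bs] by simp
    then show ?case using snoc.IH[of "a # bs"] by simp
  qed
  have "(\<lambda>l. h (x # l)) xs = (\<lambda>l. h (x # l)) (as @ bs)"
  proof (rule Cons.IH)
    show "mset xs = mset (as @ bs)" using Cons.prems(1) by (simp add: ys)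
    show "h (x # ps @ u # v # qs) = h (x # ps @ v # u # qs)" for ps u v qs
      using Cons.prems(2)[of "x # ps"] by simp
  qed
  then show ?case using front ys by simp
qed

text \<open>Move the two equal entries to the front. The sign of the rearrangement is avoided by looking at
  \<open>\<alpha>\<^sup>2\<close>, which is invariant under all swaps.\<close>

lemma skew_repeated:
  assumes "skew \<alpha>" "\<not> distinct vs" shows "\<alpha> vs = 0"
proof -
  obtain as bs cs u where vs: "vs = as @ [u] @ bs @ [u] @ cs"
    using assms(2) not_distinct_decomp by blast
  have "(\<lambda>l. \<alpha> l * \<alpha> l) vs = (\<lambda>l. \<alpha> l * \<alpha> l) (u # u # as @ bs @ cs)"
  proof (rule swap_invariant_mset)
    show "mset vs = mset (u # u # as @ bs @ cs)" by (simp add: vs)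
    show "\<alpha> (xs @ x # y # ys) * \<alpha> (xs @ x # y # ys) = \<alpha> (xs @ y # x # ys) * \<alpha> (xs @ y # x # ys)" for xs x y ys
      using skewD[OF assms(1), of xs x y ys] by simp
  qed
  moreover have "\<alpha> (u # u # as @ bs @ cs) = 0"
    using skewD[OF assms(1), of "[]" u u] by simp
  ultimately show ?thesis by simp
qed

lemma subframe_eq: "subframe e I = map e (nths indices I)"
  by (simp only: subframe_def nths_map)

text \<open>The inner product and the Hodge star are sums over all increasing index lists. On frame vectors only
  one of them contributes; here the surviving term is found without sorting its indices.\<close>

lemma sum_over_subframes:
  fixes g :: "8 list \<Rightarrow> complex"
  assumes "distinct is"
    and other: "\<And>js. distinct js \<Longrightarrow> mset js \<noteq> mset is \<Longrightarrow> g js = 0"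
    and perm: "\<And>js. mset js = mset is \<Longrightarrow> g js = g is"
  shows "(\<Sum>I\<in>Pow {..<8}. g (nths indices I)) = g is"
proof -
  have nth_inj: "i = j" if "i < 8" "j < 8" "indices ! i = indices ! j" for i j
    using that by (subst (asm) nth_eq_iff_index_eq) simp_all
  have set_nths: "set (nths indices I) = (!) indices ` I" if "I \<subseteq> {..<8}" for I
  proof -
    have "set (nths xs I) = (!) xs ` I" if "I \<subseteq> {..<length xs}" for xs :: "8 list"
      unfolding set_nths using that by auto
    moreover have "length indices = 8" by simp
    ultimately show ?thesis using that by metis
  qed
  define J where "J = {i. i < 8 \<and> indices ! i \<in> set is}"
  have mset_iff: "mset (nths indices I) = mset is \<longleftrightarrow> I = J" if I: "I \<subseteq> {..<8}" for I
  proof -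
    have surj: "\<exists>i<8. indices ! i = x" for x
    proof -
      have "x \<in> set indices" using UNIV_8 by blast
      moreover have "length indices = 8" by simp
      ultimately show ?thesis by (metis in_set_conv_nth)
    qed
    have "mset (nths indices I) = mset is \<longleftrightarrow> set (nths indices I) = set is"
      by (rule set_eq_iff_mset_eq_distinct[symmetric]) (rule distinct_nthsI, simp, rule assms(1))
    also have "\<dots> \<longleftrightarrow> I = J"
    proof
      assume *: "set (nths indices I) = set is"
      show "I = J"
        using * I nth_inj unfolding set_nths[OF I] J_def by blast
    next
      assume "I = J"
      have "g ` {i. i < 8 \<and> g i \<in> A} = A" if "\<And>x. \<exists>i<8. g i = x" for g :: "nat \<Rightarrow> 8" and A
        using that by (auto simp: image_iff) metis
      from this[OF surj, of "set is"] show "set (nths indices I) = set is"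
        unfolding set_nths[OF I] \<open>I = J\<close>[unfolded J_def, symmetric] .
    qed
    finally show ?thesis .
  qed
  have "(\<Sum>I\<in>Pow {..<8}. g (nths indices I)) = (\<Sum>I\<in>{J}. g (nths indices I))"
  proof (rule sum.mono_neutral_right)
    show "{J} \<subseteq> Pow {..<8}" by (auto simp: J_def)
    show "\<forall>I\<in>Pow {..<8} - {J}. g (nths indices I) = 0"
    proof
      fix I assume "I \<in> Pow {..<8::nat} - {J}"
      then have "mset (nths indices I) \<noteq> mset is" using mset_iff by blast
      then show "g (nths indices I) = 0" by (intro other distinct_nthsI) simp_all
    qed
  qed simp
  also have "\<dots> = g (nths indices J)" by simp
  also have "\<dots> = g is"
  proof (rule perm)
    have "J \<subseteq> {..<8}" by (auto simp: J_def)
    then show "mset (nths indices J) = mset is" using mset_iff by blast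
  qed
  finally show ?thesis .
qed

lemma homogeneous_dual_basis: "homogeneous 1 (dual_basis e i)"
  by (auto simp: homogeneous_def dual_basis_def split: list.splits)

lemma dual_basis_frame:
  assumes "basis_of T e" shows "dual_basis e i [e j] = of_bool (i = j)"
proof -
  have "inj e" "independent (range e)" using assms by (auto simp: basis_of_def)
  then show ?thesis
    by (simp add: dual_basis_def representation_basis inj_eq)
qed

lemma dual_wedge_Nil: "dual_wedge e [] = unit_form"
  by (simp add: dual_wedge_def)

lemma dual_wedge_Cons: "dual_wedge e (i # is) = wedge (dual_basis e i) (dual_wedge e is)"
  by (simp add: dual_wedge_def)

lemma skew_dual_wedge: "skew (dual_wedge e is)"
  by (induction "is") (simp_all add: dual_wedge_Nil dual_wedge_Cons skew_unit_form skew_wedge_1[OF homogeneous_dual_basis])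

lemma homogeneous_dual_wedge: "homogeneous (length is) (dual_wedge e is)"
proof (induction "is")
  case Nil show ?case by (simp add: dual_wedge_Nil homogeneous_def unit_form_def)
next
  case (Cons i "is")
  then show ?case
    using homogeneous_wedge[OF homogeneous_dual_basis Cons] by (simp add: dual_wedge_Cons)
qed

lemma homogeneous_dual_wedgeI: "length is = k \<Longrightarrow> homogeneous k (dual_wedge e is)"
  using homogeneous_dual_wedge by blast

lemma wedge_dual_basis_frame:
  assumes e: "basis_of T e" and "distinct js"
  shows "wedge (dual_basis e i) \<beta> (map e js) =
    (if i \<in> set js then (-1) ^ length (takeWhile (\<lambda>j. j \<noteq> i) js) * \<beta> (map e (remove1 i js)) else 0)"
  using assms(2)
proof (induction js arbitrary: \<beta>)
  case Nil show ?case by (simp add: wedge_1_Nil[OF homogeneous_dual_basis])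
next
  case (Cons j js)
  then show ?case
    by (auto simp: wedge_1_Cons[OF homogeneous_dual_basis] dual_basis_frame[OF e] interior_def)
qed

lemma wedge_dual_basis_frame_nonzero:
  assumes e: "basis_of T e"
  shows "wedge (dual_basis e i) \<beta> (map e js) \<noteq> 0 \<Longrightarrow>
    \<exists>xs ys. js = xs @ i # ys \<and> \<beta> (map e (xs @ ys)) \<noteq> 0"
proof (induction js arbitrary: \<beta>)
  case Nil then show ?case by (simp add: wedge_1_Nil[OF homogeneous_dual_basis])
next
  case (Cons j js)
  show ?case
  proof (cases "wedge (dual_basis e i) (interior (e j) \<beta>) (map e js) = 0")
    case True
    then have "i = j \<and> \<beta> (map e js) \<noteq> 0"
      using Cons.prems by (auto simp: wedge_1_Cons[OF homogeneous_dual_basis] dual_basis_frame[OF e])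
    then show ?thesis by (intro exI[of _ "[]"] exI[of _ js]) simp
  next
    case False
    then obtain xs ys where "js = xs @ i # ys" "interior (e j) \<beta> (map e (xs @ ys)) \<noteq> 0"
      using Cons.IH by blast
    then show ?thesis by (intro exI[of _ "j # xs"] exI[of _ ys]) (simp add: interior_def)
  qed
qed

text \<open>Every factor \<open>e\<^sup>i\<close> has to meet its own frame vector.\<close>

lemma dual_wedge_frame_nonzero:
  assumes e: "basis_of T e"
  shows "dual_wedge e is (map e js) \<noteq> 0 \<Longrightarrow> mset js = mset is"
proof (induction "is" arbitrary: js)
  case Nil then show ?case by (simp add: dual_wedge_Nil unit_form_def split: if_splits)
next
  case (Cons i "is")
  then obtain xs ys where "js = xs @ i # ys" "dual_wedge e is (map e (xs @ ys)) \<noteq> 0"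
    using wedge_dual_basis_frame_nonzero[OF e] by (metis dual_wedge_Cons)
  then show ?case using Cons.IH by fastforce
qed

lemma dual_wedge_frame_self:
  assumes e: "basis_of T e" shows "distinct is \<Longrightarrow> dual_wedge e is (map e is) = 1"
proof (induction "is")
  case Nil show ?case by (simp add: dual_wedge_Nil unit_form_def)
next
  case (Cons i "is")
  then show ?case
    using wedge_dual_basis_frame[OF e Cons.prems, of i "dual_wedge e is"] by (simp add: dual_wedge_Cons)
qed

lemma dual_wedge_frame:
  assumes e: "basis_of T e"
  shows "distinct js \<Longrightarrow> dual_wedge e is (map e js) = arrangement_sign is js"
proof (induction "is" arbitrary: js)
  case Nil show ?case by (simp add: dual_wedge_Nil unit_form_def)
next
  case (Cons i "is")
  then show ?case by (simp add: dual_wedge_Cons wedge_dual_basis_frame[OF e])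
qed

lemma wedge_unit_form_left: "wedge unit_form \<alpha> = \<alpha>"
proof
  fix vs show "wedge unit_form \<alpha> vs = \<alpha> vs"
    by (subst wedge_homogeneous0) (simp_all add: homogeneous_def unit_form_def)
qed

lemma wedge_dual_wedge_Cons: "wedge (dual_wedge e (i # is)) \<alpha> = wedge (dual_basis e i) (wedge (dual_wedge e is) \<alpha>)"
  by (simp add: dual_wedge_Cons wedge_1_assoc[OF homogeneous_dual_basis])

lemma wedge_dual_wedge_frame:
  assumes e: "basis_of T e"
  shows "distinct js \<Longrightarrow> wedge (dual_wedge e is) \<alpha> (map e js) = peel is (\<lambda>ks. \<alpha> (map e ks)) js"
proof (induction "is" arbitrary: js)
  case Nil show ?case by (simp add: dual_wedge_Nil wedge_unit_form_left)
next
  case (Cons i "is")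
  then show ?case by (simp add: wedge_dual_wedge_Cons wedge_dual_basis_frame[OF e])
qed

lemma skew_wedge_dual_wedge: "skew \<alpha> \<Longrightarrow> skew (wedge (dual_wedge e is) \<alpha>)"
  by (induction "is")
     (simp_all add: dual_wedge_Nil wedge_unit_form_left wedge_dual_wedge_Cons skew_wedge_1[OF homogeneous_dual_basis])

text \<open>Pairing with \<open>e\<^sup>I\<close> reads off a component, for any index list \<open>I\<close>: if \<open>I\<close> is not increasing, both sides
  change by the same sign, and if it has repetitions, both sides are 0.\<close>

lemma form_inner_dual_wedge:
  assumes e: "basis_of T e" and "skew \<beta>"
  shows "form_inner e \<beta> (dual_wedge e is) = \<beta> (map e is)"
proof (cases "distinct is")
  case True
  let ?g = "\<lambda>js. \<beta> (map e js) * dual_wedge e is (map e js)"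
  have "(\<Sum>I\<in>Pow {..<8}. ?g (nths indices I)) = ?g is"
  proof (rule sum_over_subframes[OF True])
    show "?g js = 0" if "mset js \<noteq> mset is" for js
      using dual_wedge_frame_nonzero[OF e] that by auto
    show "?g js = ?g is" if "mset js = mset is" for js
    proof (rule swap_invariant_mset[of ?g, OF _ that])
      show "?g (xs @ u # v # ys) = ?g (xs @ v # u # ys)" for xs u v ys
        using skewD[OF assms(2), of "map e xs" "e u" "e v" "map e ys"]
          skewD[OF skew_dual_wedge, of e "is" "map e xs" "e u" "e v" "map e ys"] by simp
    qed
  qed
  then show ?thesis
    by (simp only: form_inner_def subframe_eq dual_wedge_frame_self[OF e True] mult_1_right)
next
  case False
  have "dual_wedge e is (map e (nths indices I)) = 0" for I
  proof -
    have "distinct (nths indices I)" by (rule distinct_nthsI) simp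
    then have "mset (nths indices I) \<noteq> mset is" using False mset_eq_imp_distinct_iff by blast
    then show ?thesis using dual_wedge_frame_nonzero[OF e] by blast
  qed
  then have "form_inner e \<beta> (dual_wedge e is) = 0" by (simp add: form_inner_def subframe_eq del: nths_Cons)
  moreover have "\<beta> (map e is) = 0" using False by (intro skew_repeated[OF assms(2)]) (auto simp: distinct_map)
  ultimately show ?thesis by simp
qed

text \<open>The volume form vanishes on repeated frame vectors, so that only the index set complementary to
  \<^term>\<open>js\<close> contributes to the contraction.\<close>

lemma hodge_frame:
  assumes e: "basis_of T e" and "skew \<beta>" and m: "mset (is @ js) = mset indices"
  shows "hodge e \<beta> (map e js) = \<beta> (map e is) * volume_form e (map e (is @ js))"
proof -
  let ?g = "\<lambda>ks. \<beta> (map e ks) * volume_form e (map e ks @ map e js)"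
  have "distinct (is @ js)"
  proof -
    have "distinct indices" by simp
    then show ?thesis using m mset_eq_imp_distinct_iff by blast
  qed
  then have "distinct is" by simp
  have "(\<Sum>I\<in>Pow {..<8}. ?g (nths indices I)) = ?g is"
  proof (rule sum_over_subframes[OF \<open>distinct is\<close>])
    show "?g ks = 0" if "mset ks \<noteq> mset is" for ks
    proof -
      have "mset (ks @ js) \<noteq> mset indices" using that m by (metis add_right_cancel mset_append)
      then have "volume_form e (map e (ks @ js)) = 0"
        using dual_wedge_frame_nonzero[OF e] unfolding volume_form_def by blast
      then show ?thesis by simp
    qed
    show "?g ks = ?g is" if "mset ks = mset is" for ks
    proof (rule swap_invariant_mset[of ?g, OF _ that])
      show "?g (xs @ u # v # ys) = ?g (xs @ v # u # ys)" for xs u v ys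
        using skewD[OF assms(2), of "map e xs" "e u" "e v" "map e ys"]
          skewD[OF skew_dual_wedge, of e indices "map e xs" "e u" "e v" "map e ys @ map e js"]
        by (simp add: volume_form_def)
    qed
  qed
  then show ?thesis by (simp only: hodge_def subframe_eq map_append)
qed

lemma filter_other_indices:
  assumes "i \<noteq> j"
  shows "distinct (filter (\<lambda>k. k \<noteq> i \<and> k \<noteq> j) indices)" "length (filter (\<lambda>k. k \<noteq> i \<and> k \<noteq> j) indices) = 6"
proof -
  have *: "distinct (filter (\<lambda>k. k \<noteq> i \<and> k \<noteq> j) xs) \<and> length (filter (\<lambda>k. k \<noteq> i \<and> k \<noteq> j) xs) = 6"
    if "distinct xs" "set xs = UNIV" for xs :: "8 list"
  proof -
    have "set (filter (\<lambda>k. k \<noteq> i \<and> k \<noteq> j) xs) = UNIV - {i, j}" using that by auto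
    moreover have "distinct (filter (\<lambda>k. k \<noteq> i \<and> k \<noteq> j) xs)" using that by simp
    moreover have "card (UNIV - {i, j}) = 6" using \<open>i \<noteq> j\<close> by (simp add: card_Diff_subset)
    ultimately show ?thesis by (metis distinct_card)
  qed
  have "distinct indices" by simp
  from *[OF this UNIV_8[symmetric]]
  show "distinct (filter (\<lambda>k. k \<noteq> i \<and> k \<noteq> j) indices)" "length (filter (\<lambda>k. k \<noteq> i \<and> k \<noteq> j) indices) = 6"
    by blast+
qed

lemma hodge_frame_pair:
  assumes e: "basis_of T e" and "skew \<beta>" "i \<noteq> j"
  defines "ks \<equiv> filter (\<lambda>k. k \<noteq> i \<and> k \<noteq> j) indices"
  shows "hodge e \<beta> [e i, e j] = arrangement_sign indices (ks @ [i, j]) * \<beta> (map e ks)"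
proof -
  have dist: "distinct (ks @ [i, j])"
  proof -
    have "distinct (filter (\<lambda>k. k \<noteq> i \<and> k \<noteq> j) xs @ [i, j])" if "distinct xs" for xs
      using that \<open>i \<noteq> j\<close> by simp
    moreover have "distinct indices" by simp
    ultimately show ?thesis unfolding ks_def by blast
  qed
  have "set (filter (\<lambda>k. k \<noteq> i \<and> k \<noteq> j) xs @ [i, j]) = set xs" if "set xs = UNIV" for xs
    using that by auto
  from this[OF UNIV_8[symmetric]] have "set (ks @ [i, j]) = set indices" unfolding ks_def .
  then have "mset (ks @ [i, j]) = mset indices"
    using dist by (intro iffD1[OF set_eq_iff_mset_eq_distinct]) simp_all
  from hodge_frame[OF e \<open>skew \<beta>\<close> this] dual_wedge_frame[OF e dist, of indices] show ?thesis
    by (simp add: volume_form_def mult.commute del: map_append)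
qed

lemma homogeneous_hodge:
  assumes "homogeneous k \<beta>" shows "homogeneous (8 - k) (hodge e \<beta>)"
  unfolding homogeneous_def
proof (intro allI impI)
  fix vs assume "hodge e \<beta> vs \<noteq> 0"
  then obtain I where "\<beta> (subframe e I) * volume_form e (subframe e I @ vs) \<noteq> 0"
    unfolding hodge_def by (rule sum.not_neutral_contains_not_neutral)
  then have "length (subframe e I) = k" "length (subframe e I @ vs) = 8"
    using assms homogeneous_dual_wedge[of indices e] by (auto simp: homogeneous_def volume_form_def)
  then show "length vs = 8 - k" by simp
qed

lemma skew_hodge: "skew (hodge e \<beta>)"
proof -
  have "volume_form e (zs @ xs @ u # v # ys) = - volume_form e (zs @ xs @ v # u # ys)" for zs xs u v ys
    using skewD[OF skew_dual_wedge, of e indices "zs @ xs" u v ys] by (simp add: volume_form_def)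
  then have "hodge e \<beta> (xs @ u # v # ys) = - hodge e \<beta> (xs @ v # u # ys)" for xs u v ys
    unfolding hodge_def sum_negf[symmetric] by (intro sum.cong) (metis mult_minus_right)+
  then show ?thesis unfolding skew_def by blast
qed

section \<open>Orthogonal projections\<close>

text \<open>Complex coefficients are needed for the complexified projections; real combinations are the case
  of coefficients of the form \<^term>\<open>of_real (a k)\<close>.\<close>

definition lin_comb :: "'i set \<Rightarrow> ('i \<Rightarrow> complex) \<Rightarrow> ('i \<Rightarrow> 't form) \<Rightarrow> 't form" where
  "lin_comb K w \<tau> vs = (\<Sum>k\<in>K. w k * \<tau> k vs)"

lemma homogeneous_lin_comb:
  assumes "\<And>k. k \<in> K \<Longrightarrow> homogeneous n (\<tau> k)" shows "homogeneous n (lin_comb K w \<tau>)"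
  using assms homogeneousD by (fastforce simp: homogeneous_def lin_comb_def elim: sum.not_neutral_contains_not_neutral)

lemma skew_lin_comb:
  assumes "\<And>k. k \<in> K \<Longrightarrow> skew (\<tau> k)" shows "skew (lin_comb K w \<tau>)"
proof (rule skewI)
  fix xs u v ys
  have "w k * \<tau> k (xs @ u # v # ys) = - (w k * \<tau> k (xs @ v # u # ys))" if "k \<in> K" for k
    using skewD[OF assms[OF that], of xs u v ys] by simp
  then show "lin_comb K w \<tau> (xs @ u # v # ys) = - lin_comb K w \<tau> (xs @ v # u # ys)"
    unfolding lin_comb_def sum_negf[symmetric] by (rule sum.cong[OF refl])
qed

lemma form_inner_diff_left: "form_inner e (\<alpha> - \<beta>) \<gamma> = form_inner e \<alpha> \<gamma> - form_inner e \<beta> \<gamma>"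
  by (simp add: form_inner_def algebra_simps sum_subtractf)

lemma form_inner_add_right: "form_inner e \<gamma> (\<alpha> + \<beta>) = form_inner e \<gamma> \<alpha> + form_inner e \<gamma> \<beta>"
  by (simp add: form_inner_def algebra_simps sum.distrib)

lemma form_inner_diff_right: "form_inner e \<gamma> (\<alpha> - \<beta>) = form_inner e \<gamma> \<alpha> - form_inner e \<gamma> \<beta>"
  by (simp add: form_inner_def algebra_simps sum_subtractf)

lemma form_inner_scaleR_right: "form_inner e \<beta> (c *\<^sub>R \<alpha>) = of_real c * form_inner e \<beta> \<alpha>"
  by (simp add: form_inner_def scaleR_fun_def scaleR_conv_of_real sum_distrib_left mult_ac)

lemma form_inner_commute: "form_inner e \<alpha> \<beta> = form_inner e \<beta> \<alpha>"
  by (simp add: form_inner_def mult.commute)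

lemma form_inner_lin_comb: "form_inner e (lin_comb K w \<tau>) \<gamma> = (\<Sum>k\<in>K. w k * form_inner e (\<tau> k) \<gamma>)"
proof -
  have "form_inner e (lin_comb K w \<tau>) \<gamma>
      = (\<Sum>I\<in>Pow {..<8}. \<Sum>k\<in>K. w k * (\<tau> k (subframe e I) * \<gamma> (subframe e I)))"
    by (simp add: form_inner_def lin_comb_def sum_distrib_left mult_ac)
  also have "\<dots> = (\<Sum>k\<in>K. \<Sum>I\<in>Pow {..<8}. w k * (\<tau> k (subframe e I) * \<gamma> (subframe e I)))"
    by (rule sum.swap)
  finally show ?thesis by (simp add: form_inner_def sum_distrib_left)
qed

text \<open>With an orthogonal basis of the real subspace the projection has the usual formula. In particular
  the definite description in \<^const>\<open>orth_proj\<close> has exactly one solution, so that its value can be used.\<close>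

lemma orth_proj_eq_0_iff:
  assumes "finite K" "c \<noteq> 0"
    and orth: "\<And>k l. k \<in> K \<Longrightarrow> l \<in> K \<Longrightarrow> form_inner e (\<tau> k) (\<tau> l) = (if k = l then c else 0)"
    and S: "S = {lin_comb K (\<lambda>k. of_real (a k)) \<tau> | a. True}"
  shows "orth_proj e S \<alpha> = 0 \<longleftrightarrow> (\<forall>k\<in>K. form_inner e \<alpha> (\<tau> k) = 0)"
proof -
  define w where "w k = form_inner e \<alpha> (\<tau> k) / c" for k
  have inner_comb: "form_inner e (lin_comb K u \<tau>) (\<tau> l) = u l * c" if "l \<in> K" for u l
  proof -
    have "form_inner e (lin_comb K u \<tau>) (\<tau> l) = (\<Sum>k\<in>K. if k = l then u k * c else 0)"
      unfolding form_inner_lin_comb by (rule sum.cong) (simp_all add: orth that)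
    then show ?thesis using \<open>finite K\<close> that by simp
  qed
  have comb_in: "lin_comb K (\<lambda>k. of_real (a k)) \<tau> \<in> S" for a
    unfolding S by blast
  have compl: "complexification S = {lin_comb K u \<tau> | u. True}"
  proof (intro set_eqI iffI)
    fix \<beta> assume "\<beta> \<in> complexification S"
    then obtain a b where "\<beta> = (\<lambda>vs. lin_comb K (\<lambda>k. of_real (a k)) \<tau> vs + \<i> * lin_comb K (\<lambda>k. of_real (b k)) \<tau> vs)"
      unfolding complexification_def S by blast
    then have "\<beta> = lin_comb K (\<lambda>k. of_real (a k) + \<i> * of_real (b k)) \<tau>"
      by (simp add: fun_eq_iff lin_comb_def sum_distrib_left sum.distrib algebra_simps)
    then show "\<beta> \<in> {lin_comb K u \<tau> | u. True}" by blast
  next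
    fix \<beta> assume "\<beta> \<in> {lin_comb K u \<tau> | u. True}"
    then obtain u where u: "\<beta> = lin_comb K u \<tau>" by blast
    have "lin_comb K u \<tau> vs = lin_comb K (\<lambda>k. of_real (Re (u k))) \<tau> vs + \<i> * lin_comb K (\<lambda>k. of_real (Im (u k))) \<tau> vs" for vs
    proof -
      have "u k * \<tau> k vs = of_real (Re (u k)) * \<tau> k vs + \<i> * (of_real (Im (u k)) * \<tau> k vs)" for k
        by (subst complex_eq[of "u k"]) (simp add: algebra_simps)
      then show ?thesis by (simp add: lin_comb_def sum_distrib_left sum.distrib)
    qed
    then have "\<beta> = (\<lambda>vs. lin_comb K (\<lambda>k. of_real (Re (u k))) \<tau> vs + \<i> * lin_comb K (\<lambda>k. of_real (Im (u k))) \<tau> vs)"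
      unfolding u by (rule ext)
    moreover note comb_in[of "\<lambda>k. Re (u k)"] comb_in[of "\<lambda>k. Im (u k)"]
    ultimately show "\<beta> \<in> complexification S"
      unfolding complexification_def by blast
  qed
  have basis: "\<tau> l \<in> S" if "l \<in> K" for l
  proof -
    have "\<tau> l = lin_comb K (\<lambda>k. of_real (of_bool (k = l))) \<tau>"
    proof (rule ext)
      fix vs
      have "(\<Sum>k\<in>K. of_real (of_bool (k = l)) * \<tau> k vs) = (\<Sum>k\<in>K. if k = l then \<tau> k vs else 0)"
        by (rule sum.cong) simp_all
      then show "\<tau> l vs = lin_comb K (\<lambda>k. of_real (of_bool (k = l))) \<tau> vs"
        using \<open>finite K\<close> that by (simp add: lin_comb_def)
    qed
    then show ?thesis using comb_in[of "\<lambda>k. of_bool (k = l)"] by simp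
  qed
  \<comment> \<open>Testing against the basis determines all coefficients.\<close>
  have orth_iff: "(\<forall>\<gamma>\<in>S. form_inner e (\<alpha> - lin_comb K u \<tau>) \<gamma> = 0) \<longleftrightarrow> (\<forall>l\<in>K. u l = w l)" for u
  proof
    assume *: "\<forall>\<gamma>\<in>S. form_inner e (\<alpha> - lin_comb K u \<tau>) \<gamma> = 0"
    show "\<forall>l\<in>K. u l = w l"
    proof
      fix l assume l: "l \<in> K"
      then have "form_inner e \<alpha> (\<tau> l) = u l * c"
        using *[rule_format, OF basis[OF l]] by (simp add: form_inner_diff_left inner_comb)
      then show "u l = w l" using \<open>c \<noteq> 0\<close> by (simp add: w_def)
    qed
  next
    assume u: "\<forall>l\<in>K. u l = w l"
    have "form_inner e (\<alpha> - lin_comb K u \<tau>) (\<tau> l) = 0" if "l \<in> K" for l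
      using u that \<open>c \<noteq> 0\<close> by (simp add: form_inner_diff_left inner_comb w_def)
    then show "\<forall>\<gamma>\<in>S. form_inner e (\<alpha> - lin_comb K u \<tau>) \<gamma> = 0"
      unfolding S by (auto simp: form_inner_commute[of e "\<alpha> - lin_comb K u \<tau>"] form_inner_lin_comb intro!: sum.neutral)
  qed
  have "orth_proj e S \<alpha> = lin_comb K w \<tau>"
    unfolding orth_proj_def compl
  proof (rule the_equality)
    show "lin_comb K w \<tau> \<in> {lin_comb K u \<tau> | u. True} \<and>
        (\<forall>\<gamma>\<in>S. form_inner e (\<alpha> - lin_comb K w \<tau>) \<gamma> = 0)"
      using orth_iff[of w] by blast
  next
    fix \<beta> assume *: "\<beta> \<in> {lin_comb K u \<tau> | u. True} \<and> (\<forall>\<gamma>\<in>S. form_inner e (\<alpha> - \<beta>) \<gamma> = 0)"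
    then obtain u where u: "\<beta> = lin_comb K u \<tau>" by blast
    then have "\<forall>l\<in>K. u l = w l" using * orth_iff[of u] by blast
    then show "\<beta> = lin_comb K w \<tau>" by (simp add: u fun_eq_iff lin_comb_def)
  qed
  moreover have "lin_comb K w \<tau> = 0 \<longleftrightarrow> (\<forall>k\<in>K. w k = 0)"
  proof
    assume 0: "lin_comb K w \<tau> = 0"
    show "\<forall>k\<in>K. w k = 0"
    proof
      fix k assume "k \<in> K"
      then have "w k * c = form_inner e 0 (\<tau> k)" using inner_comb[of k w] by (simp add: 0)
      then show "w k = 0" using \<open>c \<noteq> 0\<close> by (simp add: form_inner_def)
    qed
  qed (simp add: fun_eq_iff lin_comb_def)
  ultimately show ?thesis using \<open>c \<noteq> 0\<close> by (simp add: w_def)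
qed

section \<open>Multilinear forms\<close>

text \<open>Vanishing outside \<^term>\<open>T\<close> is included, so that two such forms are equal as functions as soon as they agree on
  \<^term>\<open>T\<close>.\<close>

definition multilinear_on :: "'t::real_vector set \<Rightarrow> 't form \<Rightarrow> bool" where
  "multilinear_on T \<alpha> \<longleftrightarrow>
     (\<forall>vs. \<alpha> vs \<noteq> 0 \<longrightarrow> set vs \<subseteq> T) \<and>
     (\<forall>xs ys u v a b. set xs \<union> set ys \<union> {u, v} \<subseteq> T \<longrightarrow>
        \<alpha> (xs @ (a *\<^sub>R u + b *\<^sub>R v) # ys) = a *\<^sub>R \<alpha> (xs @ u # ys) + b *\<^sub>R \<alpha> (xs @ v # ys))"

lemma multilinear_onI:
  assumes "\<And>vs. \<alpha> vs \<noteq> 0 \<Longrightarrow> set vs \<subseteq> T"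
    and "\<And>xs ys u v a b. set xs \<subseteq> T \<Longrightarrow> set ys \<subseteq> T \<Longrightarrow> u \<in> T \<Longrightarrow> v \<in> T \<Longrightarrow>
        \<alpha> (xs @ (a *\<^sub>R u + b *\<^sub>R v) # ys) = a *\<^sub>R \<alpha> (xs @ u # ys) + b *\<^sub>R \<alpha> (xs @ v # ys)"
  shows "multilinear_on T \<alpha>"
  using assms unfolding multilinear_on_def by auto

lemma multilinear_onD:
  assumes "multilinear_on T \<alpha>"
  shows "\<alpha> vs \<noteq> 0 \<Longrightarrow> set vs \<subseteq> T"
    and "set xs \<subseteq> T \<Longrightarrow> set ys \<subseteq> T \<Longrightarrow> u \<in> T \<Longrightarrow> v \<in> T \<Longrightarrow>
        \<alpha> (xs @ (a *\<^sub>R u + b *\<^sub>R v) # ys) = a *\<^sub>R \<alpha> (xs @ u # ys) + b *\<^sub>R \<alpha> (xs @ v # ys)"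
  using assms unfolding multilinear_on_def by simp_all

lemma multilinear_on_interior:
  assumes "multilinear_on T \<alpha>" shows "multilinear_on T (interior v \<alpha>)"
proof (rule multilinear_onI)
  show "set vs \<subseteq> T" if "interior v \<alpha> vs \<noteq> 0" for vs
    using multilinear_onD(1)[OF assms, of "v # vs"] that by (simp add: interior_def)
next
  fix xs ys u w a b assume *: "set xs \<subseteq> T" "set ys \<subseteq> T" "u \<in> T" "w \<in> T"
  show "interior v \<alpha> (xs @ (a *\<^sub>R u + b *\<^sub>R w) # ys) = a *\<^sub>R interior v \<alpha> (xs @ u # ys) + b *\<^sub>R interior v \<alpha> (xs @ w # ys)"
  proof (cases "v \<in> T")
    case True
    then show ?thesis using multilinear_onD(2)[OF assms, of "v # xs" ys u w a b] * by (simp add: interior_def)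
  next
    case False
    then have "interior v \<alpha> zs = 0" for zs
      using multilinear_onD(1)[OF assms, of "v # zs"] by (auto simp: interior_def)
    then show ?thesis by simp
  qed
qed

lemma interior_linear:
  assumes "multilinear_on T \<alpha>" "subspace T" "u \<in> T" "v \<in> T"
  shows "interior (a *\<^sub>R u + b *\<^sub>R v) \<alpha> = a *\<^sub>R interior u \<alpha> + b *\<^sub>R interior v \<alpha>"
proof (rule ext)
  fix vs
  show "interior (a *\<^sub>R u + b *\<^sub>R v) \<alpha> vs = (a *\<^sub>R interior u \<alpha> + b *\<^sub>R interior v \<alpha>) vs"
  proof (cases "set vs \<subseteq> T")
    case True
    then show ?thesis
      using multilinear_onD(2)[OF assms(1), of "[]" vs u v a b] assms by (simp add: interior_def scaleR_fun_def)
  next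
    case False
    then have "\<alpha> (w # vs) = 0" for w using multilinear_onD(1)[OF assms(1), of "w # vs"] by auto
    then show ?thesis by (simp add: interior_def scaleR_fun_def)
  qed
qed

lemma interior_sum:
  assumes \<alpha>: "multilinear_on T \<alpha>" "subspace T" and "finite K" "\<And>i. i \<in> K \<Longrightarrow> e i \<in> T"
  shows "interior (\<Sum>i\<in>K. a i *\<^sub>R e i) \<alpha> = (\<Sum>i\<in>K. a i *\<^sub>R interior (e i) \<alpha>)"
  using assms(3,4)
proof (induction K rule: finite_induct)
  case empty
  show ?case using interior_linear[OF \<alpha>, of 0 0 0 0] \<open>subspace T\<close> by (simp add: subspace_0)
next
  case (insert i K)
  then have "(\<Sum>i\<in>K. a i *\<^sub>R e i) \<in> T" by (intro subspace_sum subspace_scale \<alpha>(2)) auto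
  then show ?case
    using interior_linear[OF \<alpha>, of "e i" "\<Sum>i\<in>K. a i *\<^sub>R e i" "a i" 1] insert by simp
qed

lemma wedge_vanishes_outside:
  assumes "\<And>vs. \<alpha> vs \<noteq> 0 \<Longrightarrow> set vs \<subseteq> T" "\<And>vs. \<beta> vs \<noteq> 0 \<Longrightarrow> set vs \<subseteq> T" "wedge \<alpha> \<beta> vs \<noteq> 0"
  shows "set vs \<subseteq> T"
proof
  fix v assume "v \<in> set vs"
  then obtain i where i: "i < length vs" "v = vs ! i" by (metis in_set_conv_nth)
  obtain S where "\<alpha> (nths vs S) * \<beta> (nths vs (- S)) \<noteq> 0"
    using assms(3) unfolding wedge_def by (metis (no_types, lifting) mult.assoc mult_zero_right sum.neutral)
  then have "set (nths vs S) \<subseteq> T" "set (nths vs (- S)) \<subseteq> T" using assms(1,2) by auto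
  moreover have "v \<in> set (nths vs S) \<or> v \<in> set (nths vs (- S))"
    using i by (cases "i \<in> S") (auto simp: set_nths)
  ultimately show "v \<in> T" by blast
qed

lemma multilinear_on_wedge_1:
  assumes "homogeneous 1 \<alpha>" and \<alpha>: "multilinear_on T \<alpha>" and "multilinear_on T \<beta>" "subspace T"
  shows "multilinear_on T (wedge \<alpha> \<beta>)"
proof (rule multilinear_onI)
  show "set vs \<subseteq> T" if "wedge \<alpha> \<beta> vs \<noteq> 0" for vs
    using wedge_vanishes_outside[OF multilinear_onD(1)[OF assms(2)] multilinear_onD(1)[OF assms(3)] that] .
next
  fix xs ys u v a b assume *: "set xs \<subseteq> T" "set ys \<subseteq> T" "u \<in> T" "v \<in> T"
  then show "wedge \<alpha> \<beta> (xs @ (a *\<^sub>R u + b *\<^sub>R v) # ys) = a *\<^sub>R wedge \<alpha> \<beta> (xs @ u # ys) + b *\<^sub>R wedge \<alpha> \<beta> (xs @ v # ys)"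
    using assms(3)
  proof (induction xs arbitrary: \<beta>)
    case Nil
    have "\<alpha> [a *\<^sub>R u + b *\<^sub>R v] = a *\<^sub>R \<alpha> [u] + b *\<^sub>R \<alpha> [v]"
      using multilinear_onD(2)[OF \<alpha>, of "[]" "[]"] Nil by simp
    then show ?case
      by (simp add: wedge_1_Cons[OF assms(1)] interior_linear[OF Nil.prems(5) \<open>subspace T\<close> Nil.prems(3,4)]
          wedge_add_right wedge_scaleR_right)
         (simp add: scaleR_fun_def algebra_simps)
  next
    case (Cons x xs)
    have "\<beta> (xs @ (a *\<^sub>R u + b *\<^sub>R v) # ys) = a *\<^sub>R \<beta> (xs @ u # ys) + b *\<^sub>R \<beta> (xs @ v # ys)"
      using Cons.prems by (intro multilinear_onD(2)) auto
    moreover have "wedge \<alpha> (interior x \<beta>) (xs @ (a *\<^sub>R u + b *\<^sub>R v) # ys)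
        = a *\<^sub>R wedge \<alpha> (interior x \<beta>) (xs @ u # ys) + b *\<^sub>R wedge \<alpha> (interior x \<beta>) (xs @ v # ys)"
      using Cons.prems by (intro Cons.IH multilinear_on_interior) auto
    ultimately show ?case by (simp add: wedge_1_Cons[OF assms(1)] algebra_simps)
  qed
qed

lemma subspace_of_basis: "basis_of T e \<Longrightarrow> subspace T"
  by (auto simp: basis_of_def)

lemma basis_in: "basis_of T e \<Longrightarrow> e i \<in> T"
  unfolding basis_of_def by (metis rangeI span_base)

lemma multilinear_on_dual_basis:
  assumes "basis_of T e" shows "multilinear_on T (dual_basis e i)"
proof (rule multilinear_onI)
  have ind: "independent (range e)" and T: "T = span (range e)" using assms by (auto simp: basis_of_def)
  show "set vs \<subseteq> T" if "dual_basis e i vs \<noteq> 0" for vs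
  proof -
    have "length vs = 1" using that homogeneous_dual_basis[of e i] by (auto simp: homogeneous_def)
    then obtain v where v: "vs = [v]" by (auto simp: length_Suc_conv)
    then have "v \<in> span (range e)" using that by (auto simp: dual_basis_def representation_def split: if_splits)
    then show ?thesis by (simp add: v T)
  qed
  show "dual_basis e i (xs @ (a *\<^sub>R u + b *\<^sub>R v) # ys) = a *\<^sub>R dual_basis e i (xs @ u # ys) + b *\<^sub>R dual_basis e i (xs @ v # ys)"
    if "u \<in> T" "v \<in> T" for xs ys u v a b
  proof (cases "xs = [] \<and> ys = []")
    case True
    then show ?thesis
      using that unfolding T
      by (simp add: dual_basis_def representation_add[OF ind] representation_scale[OF ind] span_scale scaleR_conv_of_real)
  next
    case False
    then have "dual_basis e i (xs @ w # ys) = 0" for w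
      by (intro homogeneousD[OF homogeneous_dual_basis]) auto
    then show ?thesis by simp
  qed
qed

lemma multilinear_on_dual_wedge:
  assumes "basis_of T e" shows "multilinear_on T (dual_wedge e is)"
proof (induction "is")
  case Nil
  show ?case by (rule multilinear_onI) (auto simp: dual_wedge_Nil unit_form_def split: if_splits)
next
  case (Cons i "is")
  show ?case unfolding dual_wedge_Cons
    by (intro multilinear_on_wedge_1 homogeneous_dual_basis multilinear_on_dual_basis[OF assms] Cons subspace_of_basis[OF assms])
qed

lemma multilinear_on_add:
  assumes \<alpha>: "multilinear_on T \<alpha>" and \<beta>: "multilinear_on T \<beta>" shows "multilinear_on T (\<alpha> + \<beta>)"
proof (rule multilinear_onI)
  show "set vs \<subseteq> T" if "(\<alpha> + \<beta>) vs \<noteq> 0" for vs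
    using that multilinear_onD(1)[OF \<alpha>, of vs] multilinear_onD(1)[OF \<beta>, of vs] by (cases "\<alpha> vs = 0") auto
qed (simp add: multilinear_onD(2)[OF \<alpha>] multilinear_onD(2)[OF \<beta>] algebra_simps)

lemma multilinear_on_diff:
  assumes \<alpha>: "multilinear_on T \<alpha>" and \<beta>: "multilinear_on T \<beta>" shows "multilinear_on T (\<alpha> - \<beta>)"
proof (rule multilinear_onI)
  show "set vs \<subseteq> T" if "(\<alpha> - \<beta>) vs \<noteq> 0" for vs
    using that multilinear_onD(1)[OF \<alpha>, of vs] multilinear_onD(1)[OF \<beta>, of vs] by (cases "\<alpha> vs = 0") auto
qed (simp add: multilinear_onD(2)[OF \<alpha>] multilinear_onD(2)[OF \<beta>] algebra_simps)

lemma multilinear_on_lin_comb: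
  assumes "\<And>k. k \<in> K \<Longrightarrow> multilinear_on T (\<tau> k)" shows "multilinear_on T (lin_comb K w \<tau>)"
proof (rule multilinear_onI)
  fix vs assume "lin_comb K w \<tau> vs \<noteq> 0"
  then obtain k where k: "k \<in> K" "w k * \<tau> k vs \<noteq> 0"
    unfolding lin_comb_def by (rule sum.not_neutral_contains_not_neutral)
  then have "\<tau> k vs \<noteq> 0" by simp
  then show "set vs \<subseteq> T" by (rule multilinear_onD(1)[OF assms[OF k(1)]])
next
  fix xs ys u v a b assume "set xs \<subseteq> T" "set ys \<subseteq> T" "u \<in> T" "v \<in> T"
  then have "\<tau> k (xs @ (a *\<^sub>R u + b *\<^sub>R v) # ys) = a *\<^sub>R \<tau> k (xs @ u # ys) + b *\<^sub>R \<tau> k (xs @ v # ys)"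
    if "k \<in> K" for k
    using multilinear_onD(2)[OF assms[OF that]] by blast
  then have "lin_comb K w \<tau> (xs @ (a *\<^sub>R u + b *\<^sub>R v) # ys)
      = (\<Sum>k\<in>K. a *\<^sub>R (w k * \<tau> k (xs @ u # ys)) + b *\<^sub>R (w k * \<tau> k (xs @ v # ys)))"
    unfolding lin_comb_def by (intro sum.cong) (simp_all add: algebra_simps)
  then show "lin_comb K w \<tau> (xs @ (a *\<^sub>R u + b *\<^sub>R v) # ys)
      = a *\<^sub>R lin_comb K w \<tau> (xs @ u # ys) + b *\<^sub>R lin_comb K w \<tau> (xs @ v # ys)"
    by (simp add: lin_comb_def scaleR_sum_right sum.distrib)
qed

lemma multilinear_on_hodge:
  assumes e: "basis_of T e" shows "multilinear_on T (hodge e \<beta>)"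
proof -
  have "multilinear_on T (\<lambda>vs. volume_form e (subframe e I @ vs))" for I
  proof -
    have sub: "set (subframe e I) \<subseteq> T"
      using basis_in[OF e] set_nths_subset unfolding subframe_eq by fastforce
    note V = multilinear_on_dual_wedge[OF e, of indices, folded volume_form_def]
    show ?thesis
    proof (rule multilinear_onI)
      show "set vs \<subseteq> T" if "volume_form e (subframe e I @ vs) \<noteq> 0" for vs
        using multilinear_onD(1)[OF V that] by simp
    next
      fix xs ys u v a b assume "set xs \<subseteq> T" "set ys \<subseteq> T" "u \<in> T" "v \<in> T"
      then show "volume_form e (subframe e I @ xs @ (a *\<^sub>R u + b *\<^sub>R v) # ys)
        = a *\<^sub>R volume_form e (subframe e I @ xs @ u # ys) + b *\<^sub>R volume_form e (subframe e I @ xs @ v # ys)"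
        using multilinear_onD(2)[OF V, of "subframe e I @ xs" ys u v a b] sub by simp
    qed
  qed
  then have "multilinear_on T (lin_comb (Pow {..<8}) (\<lambda>I. \<beta> (subframe e I)) (\<lambda>I vs. volume_form e (subframe e I @ vs)))"
    by (rule multilinear_on_lin_comb)
  moreover have "lin_comb (Pow {..<8}) (\<lambda>I. \<beta> (subframe e I)) (\<lambda>I vs. volume_form e (subframe e I @ vs)) = hodge e \<beta>"
    by (rule ext) (simp add: lin_comb_def hodge_def)
  ultimately show ?thesis by simp
qed

lemma basis_expansion:
  assumes e: "basis_of T e" and "x \<in> T" obtains r where "x = (\<Sum>i\<in>UNIV. r i *\<^sub>R e i)"
proof -
  have inj: "inj e" and T: "T = span (range e)" using e by (auto simp: basis_of_def)
  obtain u where "x = (\<Sum>v\<in>range e. u v *\<^sub>R v)"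
    using assms(2) unfolding T by (auto simp: span_finite)
  then have "x = (\<Sum>i\<in>UNIV. u (e i) *\<^sub>R e i)" by (simp add: sum.reindex[OF inj])
  then show thesis by (rule that)
qed

lemma sum_form_apply: "(\<Sum>k\<in>K. a k *\<^sub>R \<tau> k) vs = (\<Sum>k\<in>K. a k *\<^sub>R (\<tau> k vs :: complex))"
  by (induction K rule: infinite_finite_induct) (simp_all add: scaleR_fun_def)

text \<open>Both arguments are expanded in the frame.\<close>

lemma bilinear_form_eqI:
  assumes e: "basis_of T e" and \<alpha>: "homogeneous 2 \<alpha>" "multilinear_on T \<alpha>"
    and \<beta>: "homogeneous 2 \<beta>" "multilinear_on T \<beta>"
    and eq: "\<And>i j. \<alpha> [e i, e j] = \<beta> [e i, e j]"
  shows "\<alpha> = \<beta>"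
proof (rule ext)
  have expand: "\<gamma> [x, y] = (\<Sum>i\<in>UNIV. r i *\<^sub>R (\<Sum>j\<in>UNIV. s j *\<^sub>R \<gamma> [e i, e j]))"
    if "multilinear_on T \<gamma>" "x = (\<Sum>i\<in>UNIV. r i *\<^sub>R e i)" "y = (\<Sum>i\<in>UNIV. s i *\<^sub>R e i)" for \<gamma> x y r s
  proof -
    note * = interior_sum[OF _ subspace_of_basis[OF e] finite basis_in[OF e]]
    have "interior y (interior (e i) \<gamma>) [] = (\<Sum>j\<in>UNIV. s j *\<^sub>R \<gamma> [e i, e j])" for i
      unfolding that(3) *[OF multilinear_on_interior[OF that(1)]] sum_form_apply by (simp add: interior_def)
    moreover have "interior x \<gamma> [y] = (\<Sum>i\<in>UNIV. r i *\<^sub>R interior y (interior (e i) \<gamma>) [])"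
      unfolding that(2) *[OF that(1)] sum_form_apply by (simp add: interior_def)
    ultimately show ?thesis by (simp add: interior_def[of x])
  qed
  fix vs show "\<alpha> vs = \<beta> vs"
  proof (cases "length vs = 2 \<and> set vs \<subseteq> T")
    case True
    then obtain x y where vs: "vs = [x, y]" "x \<in> T" "y \<in> T"
      by (cases vs; cases "tl vs") auto
    obtain r where "x = (\<Sum>i\<in>UNIV. r i *\<^sub>R e i)" using basis_expansion[OF e vs(2)] .
    moreover obtain s where "y = (\<Sum>i\<in>UNIV. s i *\<^sub>R e i)" using basis_expansion[OF e vs(3)] .
    ultimately show ?thesis using expand[OF \<alpha>(2)] expand[OF \<beta>(2)] eq by (simp add: vs(1))
  next
    case False
    then have "\<alpha> vs = 0" "\<beta> vs = 0"
      using homogeneousD[OF \<alpha>(1)] homogeneousD[OF \<beta>(1)] multilinear_onD(1)[OF \<alpha>(2)] multilinear_onD(1)[OF \<beta>(2)] by blast+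
    then show ?thesis by simp
  qed
qed

section \<open>Orthogonal bases of the seven-dimensional subspaces\<close>

text \<open>An orthogonal basis of \<open>\<Lambda>\<^sup>2\<^sub>7\<close>, for \<open>k = 1, \<dots>, 7\<close>.\<close>

definition gamma_form :: "(8 \<Rightarrow> 't::real_vector) \<Rightarrow> 8 \<Rightarrow> 't form" where
  "gamma_form e k = dual_wedge e [0, k] + interior (e k) (G2_phi e)"

text \<open>An orthogonal basis of \<open>\<Lambda>\<^sup>4\<^sub>7\<close>, for \<open>k = 1, \<dots>, 7\<close>.\<close>

definition tau_form :: "(8 \<Rightarrow> 't::real_vector) \<Rightarrow> 8 \<Rightarrow> 't form" where
  "tau_form e k = wedge (dual_basis e 0) (interior (e k) (G2_star_phi e)) - wedge (dual_basis e k) (G2_phi e)"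

lemma interior_dual_wedge_Nil: "interior v (dual_wedge e []) = 0"
  by (rule ext) (simp add: interior_def dual_wedge_Nil unit_form_def)

lemma interior_dual_wedge_Cons:
  assumes e: "basis_of T e"
  shows "interior (e k) (dual_wedge e (i # is))
    = of_bool (k = i) *\<^sub>R dual_wedge e is - wedge (dual_basis e i) (interior (e k) (dual_wedge e is))"
  by (rule ext) (auto simp: dual_wedge_Cons interior_wedge_1[OF homogeneous_dual_basis] dual_basis_frame[OF e] scaleR_fun_def)

lemma interior_dual_wedge_3:
  assumes e: "basis_of T e"
  shows "interior (e k) (dual_wedge e [a, b, c]) = of_bool (k = a) *\<^sub>R dual_wedge e [b, c]
    - of_bool (k = b) *\<^sub>R dual_wedge e [a, c] + of_bool (k = c) *\<^sub>R dual_wedge e [a, b]"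
  by (simp add: interior_dual_wedge_Cons[OF e] interior_dual_wedge_Nil wedge_zero_right
      wedge_diff_right wedge_scaleR_right dual_wedge_Cons[symmetric])

lemma interior_dual_wedge_4:
  assumes e: "basis_of T e"
  shows "interior (e k) (dual_wedge e [a, b, c, d]) = of_bool (k = a) *\<^sub>R dual_wedge e [b, c, d]
    - of_bool (k = b) *\<^sub>R dual_wedge e [a, c, d] + of_bool (k = c) *\<^sub>R dual_wedge e [a, b, d]
    - of_bool (k = d) *\<^sub>R dual_wedge e [a, b, c]"
  by (simp add: interior_dual_wedge_Cons[OF e] interior_dual_wedge_Nil wedge_zero_right
      wedge_diff_right wedge_scaleR_right dual_wedge_Cons[symmetric])

lemma form_inner_gamma_form:
  assumes e: "basis_of T e" and "skew \<beta>"
  shows "form_inner e \<beta> (gamma_form e k) = coord2 (\<lambda>i j. \<beta> [e i, e j]) k"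
  by (simp add: gamma_form_def G2_phi_def interior_add interior_diff interior_dual_wedge_3[OF e]
      form_inner_add_right form_inner_diff_right form_inner_scaleR_right
      form_inner_dual_wedge[OF e \<open>skew \<beta>\<close>] coord2_def phi_terms_def)

lemma form_inner_tau_form:
  assumes e: "basis_of T e" and "skew \<beta>"
  shows "form_inner e \<beta> (tau_form e k) = coord4 (\<lambda>is. \<beta> (map e is)) k"
proof -
  have repeated: "of_bool (k \<notin> {a, b, c}) * \<beta> (map e [k, a, b, c]) = \<beta> (map e [k, a, b, c])" for a b c
    using skew_repeated[OF \<open>skew \<beta>\<close>, of "map e [k, a, b, c]"] by (cases "k \<in> {a, b, c}") auto
  show ?thesis
    unfolding coord4_def repeated
    by (simp add: tau_form_def G2_phi_def G2_star_phi_def interior_add interior_diff interior_dual_wedge_4[OF e]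
        wedge_add_right wedge_diff_right wedge_scaleR_right dual_wedge_Cons[symmetric]
        form_inner_add_right form_inner_diff_right form_inner_scaleR_right
        form_inner_dual_wedge[OF e \<open>skew \<beta>\<close>] phi_terms_def star_phi_terms_def)
qed

lemma skew_gamma_form: "skew (gamma_form e k)"
  unfolding gamma_form_def G2_phi_def
  by (intro skew_add skew_diff skew_interior skew_dual_wedge)

lemma skew_tau_form: "skew (tau_form e k)"
  unfolding tau_form_def G2_phi_def G2_star_phi_def
  by (intro skew_add skew_diff skew_interior skew_wedge_1[OF homogeneous_dual_basis] skew_dual_wedge)

text \<open>The inner product with an elementary 2-form is a component of the \<^const>\<open>gamma_form\<close>; by symmetry it is also a
  value of \<^const>\<open>coord2\<close>.\<close>

lemma gamma_form_frame:
  assumes e: "basis_of T e" shows "gamma_form e k [e i, e j] = gamma_mat k i j"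
proof -
  have "dual_wedge e [i, j] [e a, e b] = of_bool (a = i \<and> b = j) - of_bool (a = j \<and> b = i)" for a b
  proof -
    have "dual_wedge e [i, j] [e a, e b] = of_bool (i = a) * of_bool (j = b) - of_bool (i = b) * of_bool (j = a)"
      by (simp add: dual_wedge_Cons dual_wedge_Nil wedge_1_Cons[OF homogeneous_dual_basis]
          wedge_1_Nil[OF homogeneous_dual_basis] interior_def unit_form_def dual_basis_frame[OF e] del: of_bool_eq_0_iff of_bool_eq_1_iff)
    also have "\<dots> = of_bool (a = i \<and> b = j) - of_bool (a = j \<and> b = i)"
      unfolding of_bool_conj by (simp only: eq_commute[of a] eq_commute[of b] mult.commute)
    finally show ?thesis .
  qed
  then have "form_inner e (dual_wedge e [i, j]) (gamma_form e k) = gamma_mat k i j"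
    by (simp add: form_inner_gamma_form[OF e skew_dual_wedge] gamma_mat_def)
  then show ?thesis
    by (simp add: form_inner_commute[of e "dual_wedge e [i, j]"] form_inner_dual_wedge[OF e skew_gamma_form])
qed

lemma gamma_form_orthogonal:
  assumes e: "basis_of T e" "k \<noteq> 0" "l \<noteq> 0"
  shows "form_inner e (gamma_form e k) (gamma_form e l) = (if k = l then 4 else 0)"
proof -
  have "\<forall>k l. k \<noteq> 0 \<longrightarrow> l \<noteq> 0 \<longrightarrow> coord2 (gamma_mat k) l = (if k = l then 4 else 0)"
    unfolding all_8 coord2_simps gamma_mat_simps by simp
  then show ?thesis
    using assms(2,3) by (simp add: form_inner_gamma_form[OF e(1) skew_gamma_form] gamma_form_frame[OF e(1)])
qed

text \<open>The Gram matrix of the \<^const>\<open>tau_form\<close>s: the inner \<^const>\<open>coord4\<close> computes the components of one of them as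
  values on the elementary 4-forms, the outer one pairs these components with the other.\<close>

lemma tau_gram:
  assumes "k \<noteq> 0" "l \<noteq> 0"
  shows "coord4 (\<lambda>js. coord4 (\<lambda>is. if distinct is then arrangement_sign js is else 0) k) l
    = (if k = l then 8 else 0)"
  by (rule nonzero_index_cases[OF _ _ _ _ _ _ _ \<open>k \<noteq> 0\<close>]; rule nonzero_index_cases[OF _ _ _ _ _ _ _ \<open>l \<noteq> 0\<close>];
      simp only: coord4_simps;
      simp add: eq_8 split del: if_split)

lemma tau_form_orthogonal:
  assumes e: "basis_of T e" "k \<noteq> 0" "l \<noteq> 0"
  shows "form_inner e (tau_form e k) (tau_form e l) = (if k = l then 8 else 0)"
proof -
  have "dual_wedge e js (map e is) = (if distinct is then arrangement_sign js is else 0)" for js "is"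
    using dual_wedge_frame[OF e(1), of "is" js] skew_repeated[OF skew_dual_wedge, of "map e is" e js]
    by (cases "distinct is") (simp_all add: distinct_map)
  then have "tau_form e k (map e js) = coord4 (\<lambda>is. if distinct is then arrangement_sign js is else 0) k" for js
    using form_inner_tau_form[OF e(1) skew_dual_wedge[of e js], of k]
    by (simp add: form_inner_commute[of e "dual_wedge e js"] form_inner_dual_wedge[OF e(1) skew_tau_form])
  then show ?thesis
    using tau_gram[OF assms(2,3)] by (simp add: form_inner_tau_form[OF e(1) skew_tau_form])
qed

definition Phi_terms :: "(complex \<times> 8 list) list" where
  "Phi_terms = [(1,[0,1,2,3]), (1,[0,1,4,5]), (1,[0,1,6,7]), (1,[0,2,4,6]), (-1,[0,2,5,7]), (-1,[0,3,4,7]),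
    (-1,[0,3,5,6]), (1,[4,5,6,7]), (1,[2,3,6,7]), (1,[2,3,4,5]), (1,[1,3,5,7]), (-1,[1,3,4,6]),
    (-1,[1,2,5,6]), (-1,[1,2,4,7])]"

text \<open>It suffices to compare skew matrices above the diagonal.\<close>

definition upper_pairs :: "(8 \<times> 8) list" where
  "upper_pairs = [(0,1), (0,2), (0,3), (0,4), (0,5), (0,6), (0,7), (1,2), (1,3), (1,4), (1,5), (1,6), (1,7), (2,3),
    (2,4), (2,5), (2,6), (2,7), (3,4), (3,5), (3,6), (3,7), (4,5), (4,6), (4,7), (5,6), (5,7), (6,7)]"

lemma skew_matrix_eqI:
  assumes f: "skew_matrix f" and g: "skew_matrix g" and eq: "\<forall>(i, j)\<in>set upper_pairs. f i j = g i j"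
  shows "f i j = g i j"
proof -
  have "\<forall>i j. f i j = g i j"
    using eq unfolding all_8 upper_pairs_def
    by (simp add: skew_matrix_entries[OF f] skew_matrix_entries[OF g])
  then show ?thesis by blast
qed

lemma upper_pairs_distinct: "(i, j) \<in> set upper_pairs \<Longrightarrow> i \<noteq> j"
  by (auto simp: upper_pairs_def)

text \<open>The operator \<open>\<alpha> \<mapsto> *(\<Phi> \<and> \<alpha>)\<close> in components. It has the eigenvalue 3 on \<open>\<Lambda>\<^sup>2\<^sub>7\<close> and -1 on the
  orthogonal complement, so adding the identity gives 4 times the projection, which is \<^const>\<open>part7\<close>. In \<open>f (l ! 0) (l ! 1)\<close> the list \<open>l\<close>
  holds the two indices that a term of \<open>\<Phi>\<close> leaves over for \<open>\<alpha>\<close>.\<close>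

lemma Phi_operator:
  assumes f: "skew_matrix f"
  shows "\<forall>(i, j)\<in>set upper_pairs. (let ks = filter (\<lambda>k. k \<noteq> i \<and> k \<noteq> j) indices in
      arrangement_sign indices (ks @ [i, j]) * (\<Sum>(s, is)\<leftarrow>Phi_terms. s * peel is (\<lambda>l. f (l ! 0) (l ! 1)) ks))
    = part7 f i j - f i j"
  unfolding upper_pairs_def Let_def Phi_terms_def list.map sum_list.Cons sum_list.Nil prod.case
    list.set ball_simps
  by (intro conjI TrueI;
      simp add: eq_8 split del: if_split;
      simp add: part7_entries coord2_simps skew_matrix_entries[OF f])

lemma wedge_Phi_frame:
  assumes e: "basis_of T e" and "distinct js"
  shows "wedge (standard_Phi e) \<alpha> (map e js)
    = (\<Sum>(s, is)\<leftarrow>Phi_terms. s * peel is (\<lambda>ks. \<alpha> (map e ks)) js)"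
  unfolding standard_Phi_def wedge_add_left wedge_diff_left Phi_terms_def
  by (simp add: wedge_dual_wedge_frame[OF e \<open>distinct js\<close>] del: peel.simps)

lemma hodge_Phi_wedge_frame:
  assumes e: "basis_of T e" and \<alpha>: "skew \<alpha>"
  shows "hodge e (wedge (standard_Phi e) \<alpha>) [e i, e j] + \<alpha> [e i, e j] = part7 (\<lambda>i j. \<alpha> [e i, e j]) i j"
proof -
  define f where "f = (\<lambda>i j. \<alpha> [e i, e j])"
  define h where "h = (\<lambda>i j. hodge e (wedge (standard_Phi e) \<alpha>) [e i, e j])"
  have f: "skew_matrix f"
    unfolding f_def using skewD[OF \<alpha>, of "[]" _ _ "[]"] by (metis append_Nil)
  have h: "skew_matrix h"
    unfolding h_def using skewD[OF skew_hodge, of e _ "[]" _ _ "[]"] by (metis append_Nil)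
  have skew: "skew (wedge (standard_Phi e) \<alpha>)"
    unfolding standard_Phi_def wedge_add_left wedge_diff_left
    by (intro skew_add skew_diff skew_wedge_dual_wedge \<alpha>)
  have val: "h i j = part7 f i j - f i j" if ij: "(i, j) \<in> set upper_pairs" for i j
  proof -
    define ks where "ks = filter (\<lambda>k. k \<noteq> i \<and> k \<noteq> j) indices"
    have "i \<noteq> j" using upper_pairs_distinct[OF ij] .
    have ks: "distinct ks" "length ks = 6"
      unfolding ks_def using filter_other_indices[OF \<open>i \<noteq> j\<close>] .
    have "peel is (\<lambda>ks. \<alpha> (map e ks)) ks = peel is (\<lambda>l. f (l ! 0) (l ! 1)) ks" if "length is = 4" for "is"
    proof (rule peel_cong)
      fix l :: "8 list" assume "length l + length is = length ks"
      then have "length l = 2" using that ks by simp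
      then obtain x y where "l = [x, y]" by (auto simp: length_Suc_conv numeral_2_eq_2)
      then show "\<alpha> (map e l) = f (l ! 0) (l ! 1)" by (simp add: f_def)
    qed
    then have "wedge (standard_Phi e) \<alpha> (map e ks) = (\<Sum>(s, is)\<leftarrow>Phi_terms. s * peel is (\<lambda>l. f (l ! 0) (l ! 1)) ks)"
      unfolding wedge_Phi_frame[OF e ks(1)] by (simp add: Phi_terms_def del: peel.simps)
    then have "h i j = arrangement_sign indices (ks @ [i, j]) * (\<Sum>(s, is)\<leftarrow>Phi_terms. s * peel is (\<lambda>l. f (l ! 0) (l ! 1)) ks)"
      using hodge_frame_pair[OF e skew \<open>i \<noteq> j\<close>] unfolding h_def ks_def by simp
    then show ?thesis using Phi_operator[OF f] ij unfolding Let_def ks_def by fastforce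
  qed
  have "h i j = part7 f i j - f i j"
  proof (rule skew_matrix_eqI[OF h])
    show "skew_matrix (\<lambda>i j. part7 f i j - f i j)"
    proof (intro allI)
      fix i j have "part7 f j i = - part7 f i j" "f j i = - f i j" using skew_part7 f by blast+
      then show "part7 f j i - f j i = - (part7 f i j - f i j)" by simp
    qed
    show "\<forall>(i, j)\<in>set upper_pairs. h i j = part7 f i j - f i j" using val by blast
  qed
  then show ?thesis by (simp add: f_def h_def)
qed

lemma multilinear_on_gamma_form:
  assumes e: "basis_of T e" shows "multilinear_on T (gamma_form e k)"
  unfolding gamma_form_def G2_phi_def
  by (intro multilinear_on_add multilinear_on_diff multilinear_on_interior multilinear_on_dual_wedge[OF e])

lemma homogeneous_gamma_form: "homogeneous 2 (gamma_form e k)"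
proof -
  have "homogeneous (Suc 2) (G2_phi e)"
    unfolding G2_phi_def by (intro homogeneous_add homogeneous_diff homogeneous_dual_wedgeI) simp_all
  then show ?thesis
    unfolding gamma_form_def by (intro homogeneous_add homogeneous_interior homogeneous_dual_wedgeI) simp_all
qed

text \<open>The component identity \<open>hodge_Phi_wedge_frame\<close> for forms instead of frame values. Both inclusions
  between the eigenspace \<open>\<Lambda>\<^sup>2\<^sub>7\<close> and the span of the \<^const>\<open>gamma_form\<close>s follow from it.\<close>

lemma hodge_Phi_wedge:
  assumes e: "basis_of T e" and \<alpha>: "homogeneous 2 \<alpha>" "skew \<alpha>" "multilinear_on T \<alpha>"
  shows "hodge e (wedge (standard_Phi e) \<alpha>) + \<alpha>
    = lin_comb (UNIV - {0}) (\<lambda>k. form_inner e \<alpha> (gamma_form e k)) (gamma_form e)"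
proof (rule bilinear_form_eqI[OF e])
  have "homogeneous 4 (standard_Phi e)"
    unfolding standard_Phi_def by (intro homogeneous_add homogeneous_diff homogeneous_dual_wedgeI) simp_all
  from homogeneous_hodge[OF homogeneous_wedge[OF this \<alpha>(1)], of e]
  show "homogeneous 2 (hodge e (wedge (standard_Phi e) \<alpha>) + \<alpha>)"
    by (intro homogeneous_add \<alpha>) simp
  show "multilinear_on T (hodge e (wedge (standard_Phi e) \<alpha>) + \<alpha>)"
    by (intro multilinear_on_add multilinear_on_hodge[OF e] \<alpha>)
  show "homogeneous 2 (lin_comb (UNIV - {0}) (\<lambda>k. form_inner e \<alpha> (gamma_form e k)) (gamma_form e))"
    by (intro homogeneous_lin_comb homogeneous_gamma_form)
  show "multilinear_on T (lin_comb (UNIV - {0}) (\<lambda>k. form_inner e \<alpha> (gamma_form e k)) (gamma_form e))"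
    by (intro multilinear_on_lin_comb multilinear_on_gamma_form[OF e])
  show "(hodge e (wedge (standard_Phi e) \<alpha>) + \<alpha>) [e i, e j]
      = lin_comb (UNIV - {0}) (\<lambda>k. form_inner e \<alpha> (gamma_form e k)) (gamma_form e) [e i, e j]" for i j
    by (simp add: hodge_Phi_wedge_frame[OF e \<alpha>(2)] lin_comb_def form_inner_gamma_form[OF e \<alpha>(2)]
        gamma_form_frame[OF e] part7_def)
qed

text \<open>Antisymmetry extends from \<^term>\<open>T\<close> to all vectors, because a form vanishes as soon as one argument
  leaves \<^term>\<open>T\<close>.\<close>

lemma alt_forms_2:
  assumes "\<alpha> \<in> alt_forms T 2" "subspace T"
  shows "homogeneous 2 \<alpha>" "skew \<alpha>" "multilinear_on T \<alpha>"
proof -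
  have nz: "length vs = 2 \<and> set vs \<subseteq> T \<and> distinct vs" if "\<alpha> vs \<noteq> 0" for vs
    using assms(1) that unfolding alt_forms_def by blast
  have lin: "\<alpha> (xs @ (a *\<^sub>R u + b *\<^sub>R v) # ys) = a *\<^sub>R \<alpha> (xs @ u # ys) + b *\<^sub>R \<alpha> (xs @ v # ys)"
    if "Suc (length xs + length ys) = 2" "set xs \<union> set ys \<union> {u, v} \<subseteq> T" for xs ys u v a b
    using assms(1) that unfolding alt_forms_def by blast
  show hom: "homogeneous 2 \<alpha>" using nz by (auto simp: homogeneous_def)
  show "multilinear_on T \<alpha>"
  proof (rule multilinear_onI)
    show "set vs \<subseteq> T" if "\<alpha> vs \<noteq> 0" for vs using nz that by blast
  next
    fix xs ys u v a b assume *: "set xs \<subseteq> T" "set ys \<subseteq> T" "u \<in> T" "v \<in> T"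
    show "\<alpha> (xs @ (a *\<^sub>R u + b *\<^sub>R v) # ys) = a *\<^sub>R \<alpha> (xs @ u # ys) + b *\<^sub>R \<alpha> (xs @ v # ys)"
    proof (cases "Suc (length xs + length ys) = 2")
      case True then show ?thesis using * by (intro lin) auto
    next
      case False
      then have "\<alpha> (xs @ w # ys) = 0" for w by (intro homogeneousD[OF hom]) simp
      then show ?thesis by simp
    qed
  qed
  have swap: "\<alpha> [u, v] = - \<alpha> [v, u]" for u v
  proof (cases "u \<in> T \<and> v \<in> T")
    case True
    have 1: "\<alpha> [u + v, w] = \<alpha> [u, w] + \<alpha> [v, w]" if "w \<in> T" for w
      using lin[of "[]" "[w]" u v 1 1] True that by simp
    have 2: "\<alpha> [w, u + v] = \<alpha> [w, u] + \<alpha> [w, v]" if "w \<in> T" for w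
      using lin[of "[w]" "[]" u v 1 1] True that by simp
    have 0: "\<alpha> [w, w] = 0" for w using nz[of "[w, w]"] by auto
    have "u + v \<in> T" using True \<open>subspace T\<close> by (simp add: subspace_add)
    then have "\<alpha> [u + v, u + v] = \<alpha> [u, v] + \<alpha> [v, u]"
      using True 1[of "u + v"] 2[of u] 2[of v] 0[of u] 0[of v] by simp
    then show ?thesis using 0[of "u + v"] by (simp add: eq_neg_iff_add_eq_0)
  next
    case False
    then have "\<alpha> [u, v] = 0" "\<alpha> [v, u] = 0" using nz[of "[u, v]"] nz[of "[v, u]"] by auto
    then show ?thesis by simp
  qed
  show "skew \<alpha>"
  proof (rule skewI)
    fix xs u v ys
    show "\<alpha> (xs @ u # v # ys) = - \<alpha> (xs @ v # u # ys)"
    proof (cases "xs = [] \<and> ys = []")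
      case True then show ?thesis using swap[of u v] by simp
    next
      case False
      then have "\<alpha> (xs @ w # z # ys) = 0" for w z by (intro homogeneousD[OF hom]) auto
      then show ?thesis by simp
    qed
  qed
qed

definition real_valued :: "'t form \<Rightarrow> bool" where
  "real_valued \<alpha> \<longleftrightarrow> (\<forall>vs. \<alpha> vs \<in> \<real>)"

lemma real_valued_dual_wedge: "real_valued (dual_wedge e is)"
proof (induction "is")
  case Nil show ?case by (simp add: real_valued_def dual_wedge_Nil unit_form_def)
next
  case (Cons i "is")
  have "dual_basis e i vs \<in> \<real>" for vs by (auto simp: dual_basis_def split: list.splits)
  then show ?case
    using Cons unfolding real_valued_def dual_wedge_Cons wedge_def by (auto intro!: sum_in_Reals Reals_mult)
qed

lemma real_valued_gamma_form: "real_valued (gamma_form e k)"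
  using real_valued_dual_wedge[of e] unfolding real_valued_def gamma_form_def G2_phi_def interior_def
  by (auto simp: plus_fun_apply fun_diff_def intro!: Reals_add Reals_diff)

lemma Lambda_2_7_frame:
  assumes e: "basis_of T e"
  shows "{\<alpha> \<in> real_forms T 2. hodge e (wedge (standard_Phi e) \<alpha>) = 3 *\<^sub>R \<alpha>}
    = {lin_comb (UNIV - {0}) (\<lambda>k. of_real (a k)) (gamma_form e) | a. True}" (is "?L = ?R")
proof (intro equalityI subsetI)
  fix \<alpha> assume "\<alpha> \<in> ?L"
  then have \<alpha>: "\<alpha> \<in> alt_forms T 2" "range \<alpha> \<subseteq> \<real>" and eig: "hodge e (wedge (standard_Phi e) \<alpha>) = 3 *\<^sub>R \<alpha>"
    by (auto simp: real_forms_def)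
  define c where "c = (\<lambda>k. form_inner e \<alpha> (gamma_form e k))"
  have "c k \<in> \<real>" for k
    unfolding c_def form_inner_def using \<alpha>(2) real_valued_gamma_form[of e k]
    by (auto simp: real_valued_def intro!: sum_in_Reals Reals_mult)
  then have c: "of_real (Re (c k)) = c k" for k by (simp add: of_real_Re)
  have "3 *\<^sub>R \<alpha> + \<alpha> = lin_comb (UNIV - {0}) c (gamma_form e)"
    using hodge_Phi_wedge[OF e alt_forms_2[OF \<alpha>(1) subspace_of_basis[OF e]]] by (simp add: eig c_def)
  then have "4 * \<alpha> vs = (\<Sum>k\<in>UNIV - {0}. c k * gamma_form e k vs)" for vs
    by (simp add: fun_eq_iff lin_comb_def scaleR_fun_def scaleR_conv_of_real algebra_simps)
  then have "\<alpha> vs = (\<Sum>k\<in>UNIV - {0}. of_real (Re (c k) / 4) * gamma_form e k vs)" for vs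
    by (simp add: c sum_divide_distrib[symmetric] field_simps)
  then have "\<alpha> = lin_comb (UNIV - {0}) (\<lambda>k. of_real (Re (c k) / 4)) (gamma_form e)"
    by (simp add: fun_eq_iff lin_comb_def)
  then show "\<alpha> \<in> ?R" by (intro CollectI exI[of _ "\<lambda>k. Re (c k) / 4"] conjI TrueI)
next
  fix \<alpha> assume "\<alpha> \<in> ?R"
  then obtain a :: "8 \<Rightarrow> real" where a: "\<alpha> = lin_comb (UNIV - {0}) (\<lambda>k. of_real (a k)) (gamma_form e)" by blast
  have \<alpha>: "homogeneous 2 \<alpha>" "skew \<alpha>" "multilinear_on T \<alpha>"
    unfolding a by (intro homogeneous_lin_comb homogeneous_gamma_form skew_lin_comb skew_gamma_form
        multilinear_on_lin_comb multilinear_on_gamma_form[OF e])+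
  have "\<alpha> \<in> alt_forms T 2"
    unfolding alt_forms_def using \<alpha> skew_repeated[OF \<alpha>(2)] multilinear_onD[OF \<alpha>(3)]
    by (auto simp: homogeneous_def)
  moreover have "range \<alpha> \<subseteq> \<real>"
    using real_valued_gamma_form[of e] unfolding a lin_comb_def real_valued_def
    by (auto intro!: sum_in_Reals Reals_mult)
  moreover have "hodge e (wedge (standard_Phi e) \<alpha>) = 3 *\<^sub>R \<alpha>"
  proof -
    have "form_inner e \<alpha> (gamma_form e k) = 4 * of_real (a k)" if "k \<noteq> 0" for k
    proof -
      have "form_inner e \<alpha> (gamma_form e k) = (\<Sum>l\<in>UNIV - {0}. if l = k then 4 * of_real (a l) else 0)"
        unfolding a form_inner_lin_comb by (rule sum.cong) (auto simp: gamma_form_orthogonal[OF e] that)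
      then show ?thesis using that by simp
    qed
    then have "lin_comb (UNIV - {0}) (\<lambda>k. form_inner e \<alpha> (gamma_form e k)) (gamma_form e) = 4 *\<^sub>R \<alpha>"
      by (simp add: fun_eq_iff a[THEN fun_cong] lin_comb_def scaleR_fun_def scaleR_conv_of_real sum_distrib_left mult.assoc)
    then have "hodge e (wedge (standard_Phi e) \<alpha>) + \<alpha> = 4 *\<^sub>R \<alpha>"
      using hodge_Phi_wedge[OF e \<alpha>] by simp
    then show ?thesis by (simp add: fun_eq_iff scaleR_fun_def scaleR_conv_of_real eq_diff_eq[symmetric])
  qed
  ultimately show "\<alpha> \<in> ?L" by (simp add: real_forms_def)
qed

lemma wedge_sum_left: "wedge (\<Sum>i\<in>K. a i *\<^sub>R \<alpha> i) \<beta> = (\<Sum>i\<in>K. a i *\<^sub>R wedge (\<alpha> i) \<beta>)"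
  by (induction K rule: infinite_finite_induct) (simp_all only: sum.infinite sum.empty sum.insert wedge_zero_left wedge_add_left wedge_scaleR_left not_False_eq_True)

lemma wedge_sum_right: "wedge \<beta> (\<Sum>i\<in>K. a i *\<^sub>R \<alpha> i) = (\<Sum>i\<in>K. a i *\<^sub>R wedge \<beta> (\<alpha> i))"
  by (induction K rule: infinite_finite_induct) (simp_all only: sum.infinite sum.empty sum.insert wedge_zero_right wedge_add_right wedge_scaleR_right not_False_eq_True)

lemma Lambda_4_7_frame:
  assumes e: "basis_of T e"
  shows "{wedge (dual_basis e 0) (interior (\<Sum>i\<in>UNIV. a i *\<^sub>R e i) (G2_star_phi e))
       - wedge (\<Sum>i\<in>UNIV. a i *\<^sub>R dual_basis e i) (G2_phi e) | a. a 0 = 0}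
    = {lin_comb (UNIV - {0}) (\<lambda>k. of_real (a k)) (tau_form e) | a. True}" (is "{?form a | a. a 0 = 0} = ?R")
proof -
  have "multilinear_on T (G2_star_phi e)"
    unfolding G2_star_phi_def by (intro multilinear_on_add multilinear_on_diff multilinear_on_dual_wedge[OF e])
  note int = interior_sum[OF this subspace_of_basis[OF e] finite basis_in[OF e]]
  have form: "?form a = lin_comb (UNIV - {0}) (\<lambda>k. of_real (a k)) (tau_form e)" if "a 0 = 0" for a
  proof (rule ext)
    fix vs
    have "?form a vs = (\<Sum>i\<in>UNIV. of_real (a i) * tau_form e i vs)"
      unfolding int wedge_sum_left wedge_sum_right fun_diff_def sum_form_apply tau_form_def
      by (simp add: sum_subtractf[symmetric] scaleR_conv_of_real algebra_simps)
    also have "\<dots> = (\<Sum>i\<in>UNIV - {0}. of_real (a i) * tau_form e i vs)"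
      by (simp add: sum.remove[of UNIV 0] that)
    finally show "?form a vs = lin_comb (UNIV - {0}) (\<lambda>k. of_real (a k)) (tau_form e) vs"
      by (simp add: lin_comb_def)
  qed
  show ?thesis
  proof (intro equalityI subsetI)
    fix \<beta> assume "\<beta> \<in> {?form a | a. a 0 = 0}"
    then show "\<beta> \<in> ?R" using form by blast
  next
    fix \<beta> assume "\<beta> \<in> ?R"
    then obtain a :: "8 \<Rightarrow> real" where "\<beta> = lin_comb (UNIV - {0}) (\<lambda>k. of_real (a k)) (tau_form e)" by blast
    also have "\<dots> = ?form (a(0 := 0))"
      by (subst form) (simp_all add: fun_eq_iff lin_comb_def)
    finally have "\<beta> = ?form (a(0 := 0)) \<and> (a(0 := 0)) 0 = 0" by simp
    then show "\<beta> \<in> {?form a | a. a 0 = 0}" by blast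
  qed
qed

section \<open>The projection of the square of a 2-form\<close>

lemma pf_frame:
  "pf4 (\<lambda>u v. \<alpha> [u, v]) (e a) (e b) (e c) (e d) = pf4 (\<lambda>i j. \<alpha> [e i, e j]) a b c d"
  "pf6 (\<lambda>u v. \<alpha> [u, v]) (e a) (e b) (e c) (e d) (e g) (e h) = pf6 (\<lambda>i j. \<alpha> [e i, e j]) a b c d g h"
  "pf8 (\<lambda>u v. \<alpha> [u, v]) (e a) (e b) (e c) (e d) (e g) (e h) (e i) (e j)
     = pf8 (\<lambda>i j. \<alpha> [e i, e j]) a b c d g h i j"
  by (simp_all add: pf4_def pf6_def pf8_def)

lemma hodge_cube:
  assumes e: "basis_of T e" and \<alpha>: "homogeneous 2 \<alpha>" "skew \<alpha>"
  shows "hodge e (wedge_power \<alpha> 3) [e i, e j] = 6 * pf_adjugate (\<lambda>i j. \<alpha> [e i, e j]) i j"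
proof (cases "i = j")
  case True
  then show ?thesis using skew_repeated[OF skew_hodge, of "[e j, e j]" e] by (simp add: pf_adjugate_def)
next
  case False
  define ks where "ks = filter (\<lambda>k. k \<noteq> i \<and> k \<noteq> j) indices"
  have "length ks = 6" unfolding ks_def by (rule filter_other_indices(2)[OF False])
  then have ks: "ks = [ks!0, ks!1, ks!2, ks!3, ks!4, ks!5]"
    by (auto simp: eval_nat_numeral length_Suc_conv)
  have "wedge_power \<alpha> 3 (map e ks) = 6 * pf6 (\<lambda>i j. \<alpha> [e i, e j]) (ks!0) (ks!1) (ks!2) (ks!3) (ks!4) (ks!5)"
    by (subst ks) (simp add: wedge_power_pf(2)[OF \<alpha>(1)] pf_frame(2))
  then show ?thesis
    using hodge_frame_pair[OF e skew_wedge_power[OF \<alpha>] False, of 3] False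
    unfolding pf_adjugate_def Let_def ks_def by simp
qed

lemma hodge_fourth_power:
  assumes e: "basis_of T e" and \<alpha>: "homogeneous 2 \<alpha>" "skew \<alpha>"
  shows "hodge e (wedge_power \<alpha> 4) [] = 24 * pf8 (\<lambda>i j. \<alpha> [e i, e j]) 0 1 2 3 4 5 6 7"
proof -
  have "volume_form e (map e indices) = 1"
    unfolding volume_form_def by (rule dual_wedge_frame_self[OF e]) simp
  then show ?thesis
    using hodge_frame[OF e skew_wedge_power[OF \<alpha>, of 4], of indices "[]"]
    by (simp add: wedge_power_pf(3)[OF \<alpha>(1)] pf_frame(3))
qed

text \<open>Let \<open>f\<close> and \<open>s\<close> be the matrices of \<open>\<alpha>\<close> and \<open>* \<alpha>\<^sup>3 / 6\<close>. They commute and, by assumption, have opposite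
  parts in \<open>\<Lambda>\<^sup>2\<^sub>7\<close>. So their squares have the same part in \<open>\<Lambda>\<^sup>4\<^sub>7\<close>; but the part of the square of \<open>s\<close> is
  also \<open>Pf(f)\<close> times that of the square of \<open>f\<close>, and \<open>Pf(f) = * \<alpha>\<^sup>4 / 24\<close> is not 1.\<close>

lemma square_orthogonal_to_tau_form:
  assumes e: "basis_of T e" and \<alpha>: "\<alpha> \<in> alt_forms T 2"
    and pf: "hodge e (wedge_power \<alpha> 4) [] / 24 \<noteq> 1"
    and \<rho>: "\<And>k. k \<noteq> 0 \<Longrightarrow> form_inner e (\<alpha> + (1/6) *\<^sub>R hodge e (wedge_power \<alpha> 3)) (gamma_form e k) = 0"
    and "k \<noteq> 0"
  shows "form_inner e (wedge_power \<alpha> 2) (tau_form e k) = 0"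
proof -
  note \<alpha>2 = alt_forms_2[OF \<alpha> subspace_of_basis[OF e]]
  define f where "f = (\<lambda>i j. \<alpha> [e i, e j])"
  define \<beta> where "\<beta> = (\<lambda>is. wedge_power \<alpha> 2 (map e is) / 2)"
  define \<gamma> where "\<gamma> = (\<lambda>is. pf4 (pf_adjugate f) (is!0) (is!1) (is!2) (is!3))"
  have f: "skew_matrix f"
    unfolding f_def using skewD[OF \<alpha>2(2), of "[]" _ _ "[]"] by (metis append_Nil)
  have \<beta>: "\<beta> [a, b, c, d] = pf4 f a b c d" for a b c d
    by (simp add: \<beta>_def f_def wedge_power_pf(1)[OF \<alpha>2(1)] pf_frame(1))
  have \<gamma>: "\<gamma> [a, b, c, d] = pf4 (pf_adjugate f) a b c d" for a b c d
    by (simp add: \<gamma>_def numeral_eq_Suc)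
  have opp: "coord2 (pf_adjugate f) k = - coord2 f k" if "k \<noteq> 0" for k
  proof -
    have "skew (\<alpha> + (1/6) *\<^sub>R hodge e (wedge_power \<alpha> 3))"
      by (intro skew_add skew_scaleR skew_hodge \<alpha>2)
    from form_inner_gamma_form[OF e this, of k] \<rho>[OF that]
    have "coord2 (\<lambda>i j. f i j + pf_adjugate f i j) k = 0"
      by (simp add: scaleR_fun_def scaleR_conv_of_real hodge_cube[OF e \<alpha>2(1,2)] f_def)
    moreover have "coord2 (\<lambda>i j. f i j + pf_adjugate f i j) k = coord2 f k + coord2 (pf_adjugate f) k"
      by (simp add: coord2_def phi_terms_def algebra_simps)
    ultimately show ?thesis by (simp add: eq_neg_iff_add_eq_0 add.commute)
  qed
  have "coord4 \<beta> k = coord4 \<gamma> k"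
    by (rule coord4_eq_of_commuting[OF f skew_pf_adjugate \<open>k \<noteq> 0\<close> bracket_pf_adjugate[OF f] opp \<beta> \<gamma>])
  also have "\<dots> = pf8 f 0 1 2 3 4 5 6 7 * coord4 \<beta> k"
    by (rule coord4_pf_adjugate[OF f \<open>k \<noteq> 0\<close> \<beta> \<gamma>])
  finally have "(1 - pf8 f 0 1 2 3 4 5 6 7) * coord4 \<beta> k = 0" by (simp add: algebra_simps)
  moreover have "pf8 f 0 1 2 3 4 5 6 7 \<noteq> 1"
    using pf by (simp add: hodge_fourth_power[OF e \<alpha>2(1,2)] f_def)
  ultimately have "coord4 \<beta> k = 0" by simp
  moreover have "form_inner e (wedge_power \<alpha> 2) (tau_form e k) = 2 * coord4 \<beta> k"
    unfolding form_inner_tau_form[OF e skew_wedge_power[OF \<alpha>2(1,2)]] \<beta>_def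
    by (simp add: coord4_def phi_terms_def star_phi_terms_def algebra_simps)
  ultimately show ?thesis by simp
qed

theorem proposition3p3:
  fixes A :: "'m::{t2_space, second_countable_topology} atlas"
    and \<Phi> :: "'m \<Rightarrow> 'm tangent form"
    and sc :: "complex \<Rightarrow> 'v::ab_group_add \<Rightarrow> 'v"
    and L :: "'m \<Rightarrow> 'v set"
    and \<F> :: "('m set \<times> ('m \<Rightarrow> 'v)) set"
    and h :: "'m \<Rightarrow> 'v \<Rightarrow> 'v \<Rightarrow> complex"
    and D :: "('m \<Rightarrow> 'm tangent) \<Rightarrow> ('m \<Rightarrow> 'v) \<Rightarrow> 'm \<Rightarrow> 'v"
    and F :: "'m \<Rightarrow> 'm tangent form"
  assumes "compact (UNIV :: 'm set)" and "connected (UNIV :: 'm set)"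
    and "oriented_atlas A"
    and "spin7_structure A \<Phi>"
    and "line_bundle A sc L \<F>"
    and "hermitian_metric A sc L \<F> h"
    and "hermitian_connection A sc L \<F> h D"
    and "curvature_form A sc L \<F> D F"
    and "\<forall>p. spin7_hodge A \<Phi> p (wedge_power (F p) 4) [] / 24 \<noteq> 1"
    and "\<forall>p. pi_2_7 A \<Phi> p (F p + (1/6) *\<^sub>R spin7_hodge A \<Phi> p (wedge_power (F p) 3)) = 0"
  shows "\<forall>p. pi_4_7 A \<Phi> p (wedge_power (F p) 2) = 0"
proof
  fix p
  define e where "e = some_spin7_basis A \<Phi> p"
  define T where "T = tangent_space A p"
  have "\<exists>e. spin7_basis A \<Phi> p e" using assms(4) by (simp add: spin7_structure_def)
  then have "spin7_basis A \<Phi> p e" unfolding e_def some_spin7_basis_def by (rule someI_ex)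
  then have e: "basis_of T e" and \<Phi>: "\<Phi> p = standard_Phi e"
    by (simp_all add: spin7_basis_def T_def)
  have F: "F p \<in> alt_forms T 2"
    using assms(8) by (simp add: curvature_form_def smooth_form_def T_def)
  have hodge: "spin7_hodge A \<Phi> p = hodge e" by (simp add: spin7_hodge_def e_def)
  have L2: "Lambda_2_7 A \<Phi> p = {lin_comb (UNIV - {0}) (\<lambda>k. of_real (a k)) (gamma_form e) | a. True}"
    unfolding Lambda_2_7_def hodge \<Phi> T_def[symmetric] by (rule Lambda_2_7_frame[OF e])
  have L4: "Lambda_4_7 A \<Phi> p = {lin_comb (UNIV - {0}) (\<lambda>k. of_real (a k)) (tau_form e) | a. True}"
    unfolding Lambda_4_7_def Let_def e_def[symmetric] by (rule Lambda_4_7_frame[OF e])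
  have proj2: "pi_2_7 A \<Phi> p \<alpha> = 0 \<longleftrightarrow> (\<forall>k\<in>UNIV - {0}. form_inner e \<alpha> (gamma_form e k) = 0)" for \<alpha>
    unfolding pi_2_7_def e_def[symmetric]
    by (rule orth_proj_eq_0_iff[OF finite _ _ L2, of 4]) (simp_all add: gamma_form_orthogonal[OF e])
  have proj4: "pi_4_7 A \<Phi> p \<alpha> = 0 \<longleftrightarrow> (\<forall>k\<in>UNIV - {0}. form_inner e \<alpha> (tau_form e k) = 0)" for \<alpha>
    unfolding pi_4_7_def e_def[symmetric]
    by (rule orth_proj_eq_0_iff[OF finite _ _ L4, of 8]) (simp_all add: tau_form_orthogonal[OF e])
  show "pi_4_7 A \<Phi> p (wedge_power (F p) 2) = 0"
    unfolding proj4
  proof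
    fix k :: 8 assume "k \<in> UNIV - {0}"
    then have "k \<noteq> 0" by simp
    show "form_inner e (wedge_power (F p) 2) (tau_form e k) = 0"
    proof (rule square_orthogonal_to_tau_form[OF e F _ _ \<open>k \<noteq> 0\<close>])
      show "hodge e (wedge_power (F p) 4) [] / 24 \<noteq> 1"
        using assms(9)[rule_format, of p] unfolding hodge .
      show "form_inner e (F p + (1/6) *\<^sub>R hodge e (wedge_power (F p) 3)) (gamma_form e k) = 0" if "k \<noteq> 0" for k
        using assms(10)[rule_format, of p] that unfolding hodge proj2 by blast
    qed
  qed
qed

end
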